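(* Let $(\mathbb{P};\mathcal{F},\Delta)$ be a discrete-time one-dimensional noise on a probability space $(\Omega,\mathcal{G},\mathbb{P})$, symmetric under a time-reversal $\mathsf{r}$. There is, up to $\mathbb{P}$-a.s. equality, a one-to-one and onto correspondence between honest symmetric splitting families $\tau$ and self-dual stopping times $\gamma$ for $(\mathbb{P};\mathcal{F},\Delta,\mathsf{r})$, given by the mutually inverse associations $$\gamma\mapsto \llbracket\gamma\rrbracket\qquad\text{and}\qquad \tau\mapsto (\!(\tau)\!):=\inf\{n\in\mathbb{N}:\tau_n=n\}.$$ That is: if $\gamma$ is a self-dual stopping time, then $\llbracket\gamma\rrbracket$ is an honest symmetric splitting family and $(\!(\llbracket\gamma\rrbracket)\!)=\gamma$ $\mathbb{P}$-a.s.; and if $\tau$ is an honest symmetric splitting family, then $(\!(\tau)\!)$ is a self-dual stopping time and $\llbracket(\!(\tau)\!)\rrbracket=\tau$ $\mathbb{P}$-a.s.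
   Context: Noise symmetric under time-reversal. $(\Omega,\mathcal{G},\mathbb{P})$ is a probability space; $\mathcal{F}=(\mathcal{F}_{m,n})_{(m,n)\in\mathbb{Z}^2,\,m\le n}$ is a family of sub-$\sigma$-fields of $\mathcal{G}$, each $\mathbb{P}$-complete in the sense that it contains $\mathbb{P}^{-1}(\{0,1\})$, i.e. every event of $\mathcal{G}$ having probability $0$ or $1$; $\Delta=(\Delta_h)_{h\in\mathbb{Z}}$ is a $\mathbb{Z}$-indexed group of transformations of $\Omega$ ($\Delta_0=\mathrm{id}_\Omega$, $\Delta_{h+k}=\Delta_h\circ\Delta_k$), each $\mathcal{G}/\mathcal{G}$-measurable and preserving $\mathbb{P}$. $(\mathbb{P};\mathcal{F},\Delta)$ is a (discrete-time one-dimensional) noise if: (i) $\bigvee_{n\in\mathbb{N}_0}\mathcal{F}_{-n,n}=\mathcal{G}$; (ii) $\Delta_h^{-1}\mathcal{F}_{m,n}=\mathcal{F}_{m+h,n+h}$ for all integers $m\le n$ and $h$; (iii) for all integers $l\le m\le n$, $\mathcal{F}_{l,m}$ and $\mathcal{F}_{m,n}$ are independent and $\mathcal{F}_{l,m}\vee\mathcal{F}_{m,n}=\mathcal{F}_{l,n}$. It is symmetric under the time-reversal $\mathsf{r}$ if $\mathsf{r}:\Omega\to\Omega$ is an involution ($\mathsf{r}\circ\mathsf{r}=\mathrm{id}_\Omega$), $\mathcal{G}/\mathcal{G}$-measurable, preserving $\mathbb{P}$, and such that: (iv) $\mathsf{r}\circ\Delta_h=\Delta_{-h}\circ\mathsf{r}$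 for all integers $h$; (v) $\mathsf{r}^{-1}\mathcal{F}_{m,n}=\mathcal{F}_{-n,-m}$ for all integers $m\le n$. Write $\mathcal{F}_n:=\mathcal{F}_{0,n}$ for $n\in\mathbb{N}_0$ and $\mathcal{F}_\infty:=\bigvee_{n\in\mathbb{N}_0}\mathcal{F}_{0,n}$. Symmetric splitting. For $p\in(0,1)$, let (on an enlargement of the probability space, e.g. the product of $\Omega$ with $\mathbb{N}_0$) $\mathsf{g}_p$ be a random time independent of $\mathcal{G}$ with $\mathbb{P}(\mathsf{g}_p=k)=p(1-p)^k$, $k\in\mathbb{N}_0$. A family $\tau=(\tau_n)_{n\in\mathbb{N}_0}$, with $\tau_n$ being $\{0,\ldots,n\}$-valued and $\mathcal{F}_n$-measurable for each $n$, is symmetric splitting for $(\mathbb{P};\mathcal{F},\Delta,\mathsf{r})$ if, for all $p\in(0,1)$, the pairs $(\mathsf{r}\circ\Delta_{\tau_{\mathsf{g}_p}},\tau_{\mathsf{g}_p})$ and $(\Delta_{\tau_{\mathsf{g}_p}},\mathsf{g}_p-\tau_{\mathsf{g}_p})$, viewed as random elements of $(\Omega\times\mathbb{N}_0,\mathcal{F}_\infty\otimes 2^{\mathbb{N}_0})$, are independent and have the same distribution. Here $\tau_{\mathsf{g}_p}$ is $\tau_n$ on $\{\mathsf{g}_p=n\}$, and $\Delta_{\tau_{\mathsf{g}_p}}$ is $\Delta_m$ on $\{\tau_{\mathsf{g}_p}=m\}$. Honesty. For such a family $\tau$ put $\tau_{m,n}:=m+\tau_{n-m}\circ\Delta_m$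 for integers $m\le n$. The family $\tau$ is honest if $\tau_{m,n}=\tau_{k,l}$ $\mathbb{P}$-a.s. on $\{\tau_{m,n}\in[k,l]\}$ for all integers $m\le k\le l\le n$. Self-dual stopping times. Let $\gamma$ be a stopping time in the filtration $(\mathcal{F}_n)_{n\in\mathbb{N}}$ with values in $\mathbb{N}\cup\{\infty\}$, where $\mathbb{N}=\{1,2,\ldots\}$. Define $\gamma^0:=0$ and inductively $\gamma^{n+1}:=\gamma^n+\mathbf{1}_{\{\gamma^n<\infty\}}\,\gamma(\Delta_{\gamma^n})$ for $n\in\mathbb{N}_0$ (so $\gamma^{n+1}=\infty$ if $\gamma^n=\infty$); the random set $\mathcal{R}\llbracket\gamma\rrbracket:=\{\gamma^n:n\in\mathbb{N}_0\}\cap[0,\infty)$; and $\llbracket\gamma\rrbracket_n:=\max([0,n]\cap\mathcal{R}\llbracket\gamma\rrbracket)$ for $n\in\mathbb{N}_0$, $\llbracket\gamma\rrbracket:=(\llbracket\gamma\rrbracket_n)_{n\in\mathbb{N}_0}$. The stopping time $\gamma$ is self-dual for $(\mathbb{P};\mathcal{F},\Delta,\mathsf{r})$ if for all $n\in\mathbb{N}_0$, $\mathbb{P}$-a.s., $$\{n\in\mathcal{R}\llbracket\gamma\rrbracket\}=(\mathsf{r}\circ\Delta_n)^{-1}\{n<\gamma\}.$$ Conventions: $\inf\emptyset:=\infty$; equality of events $\mathbb{P}$-a.s. means that their symmetric difference is $\mathbb{P}$-null; two families (resp. stopping times) are identified when they are equal $\mathbb{P}$-a.s. *)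

theory Defs
  imports "HOL-Probability.Probability"
begin

text \<open>
  Sub-sigma-fields are represented as measures, of which only the space and the sets matter
  (as in \<^const>\<open>subalgebra\<close>). Functions are constrained on the space of the probability
  space only, and \<open>F m n\<close> is constrained only for \<open>m \<le> n\<close>.
\<close>

locale noise = prob_space M
  for M :: "'a measure" +
  fixes F :: "int \<Rightarrow> int \<Rightarrow> 'a measure"
    and \<Delta> :: "int \<Rightarrow> 'a \<Rightarrow> 'a"
  assumes subalgebra_F: "m \<le> n \<Longrightarrow> subalgebra M (F m n)"
    and complete_F: "m \<le> n \<Longrightarrow> A \<in> sets M \<Longrightarrow> prob A \<in> {0, 1} \<Longrightarrow> A \<in> sets (F m n)"
    and shift_measurable: "\<Delta> h \<in> M \<rightarrow>\<^sub>M M"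
    and shift_preserving: "distr M M (\<Delta> h) = M"
    and shift_zero: "\<omega> \<in> space M \<Longrightarrow> \<Delta> 0 \<omega> = \<omega>"
    and shift_add: "\<omega> \<in> space M \<Longrightarrow> \<Delta> (h + k) \<omega> = \<Delta> h (\<Delta> k \<omega>)"
    and generate_F: "sigma_sets (space M) (\<Union>n::nat. sets (F (- int n) (int n))) = sets M"
    and shift_F: "m \<le> n \<Longrightarrow>
      {\<Delta> h -` A \<inter> space M | A. A \<in> sets (F m n)} = sets (F (m + h) (n + h))"
    and indep_F: "l \<le> m \<Longrightarrow> m \<le> n \<Longrightarrow> indep_set (sets (F l m)) (sets (F m n))"
    and join_F: "l \<le> m \<Longrightarrow> m \<le> n \<Longrightarrow>
      sigma_sets (space M) (sets (F l m) \<union> sets (F m n)) = sets (F l n)"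

locale time_symmetric_noise = noise M F \<Delta>
  for M :: "'a measure" and F :: "int \<Rightarrow> int \<Rightarrow> 'a measure" and \<Delta> :: "int \<Rightarrow> 'a \<Rightarrow> 'a" +
  fixes r :: "'a \<Rightarrow> 'a"
  assumes reversal_measurable: "r \<in> M \<rightarrow>\<^sub>M M"
    and reversal_preserving: "distr M M r = M"
    and reversal_involution: "\<omega> \<in> space M \<Longrightarrow> r (r \<omega>) = \<omega>"
    and reversal_shift: "\<omega> \<in> space M \<Longrightarrow> r (\<Delta> h \<omega>) = \<Delta> (- h) (r \<omega>)"
    and reversal_F: "m \<le> n \<Longrightarrow> {r -` A \<inter> space M | A. A \<in> sets (F m n)} = sets (F (- n) (- m))"

definition F_infty :: "'a measure \<Rightarrow> (int \<Rightarrow> int \<Rightarrow> 'a measure) \<Rightarrow> 'a measure" where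
  "F_infty M F = sigma (space M) (\<Union>n::nat. sets (F 0 (int n)))"

subsection \<open>Honest symmetric splitting families\<close>

definition random_index_family :: "(int \<Rightarrow> int \<Rightarrow> 'a measure) \<Rightarrow> (nat \<Rightarrow> 'a \<Rightarrow> nat) \<Rightarrow> bool" where
  "random_index_family F \<tau> \<longleftrightarrow> (\<forall>n. \<tau> n \<in> F 0 (int n) \<rightarrow>\<^sub>M count_space {0..n})"

text \<open>
  The enlargement is the product of \<open>M\<close> with the geometric law on the naturals (whose mass at
  \<open>k\<close> is \<open>p (1 - p)^k\<close>), and the independent geometric time is the second coordinate \<open>g\<close>.
  The subtraction \<open>g - \<tau> g \<omega>\<close> never truncates because \<open>\<tau> g\<close> is at most \<open>g\<close>; the predicate
  \<^const>\<open>prob_space.indep_var\<close> includes measurability of both pairs.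
\<close>

definition symmetric_splitting ::
  "'a measure \<Rightarrow> (int \<Rightarrow> int \<Rightarrow> 'a measure) \<Rightarrow> (int \<Rightarrow> 'a \<Rightarrow> 'a) \<Rightarrow> ('a \<Rightarrow> 'a) \<Rightarrow>
    (nat \<Rightarrow> 'a \<Rightarrow> nat) \<Rightarrow> bool" where
  "symmetric_splitting M F \<Delta> r \<tau> \<longleftrightarrow>
     random_index_family F \<tau> \<and>
     (\<forall>p::real. 0 < p \<and> p < 1 \<longrightarrow>
       (let N = M \<Otimes>\<^sub>M measure_pmf (geometric_pmf p);
            S = F_infty M F \<Otimes>\<^sub>M count_space (UNIV :: nat set);
            X = (\<lambda>(\<omega>, g). (r (\<Delta> (int (\<tau> g \<omega>)) \<omega>), \<tau> g \<omega>));
            Y = (\<lambda>(\<omega>, g). (\<Delta> (int (\<tau> g \<omega>)) \<omega>, g - \<tau> g \<omega>))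
        in prob_space.indep_var N S X S Y \<and> distr N S X = distr N S Y))"

definition shifted_time ::
  "(int \<Rightarrow> 'a \<Rightarrow> 'a) \<Rightarrow> (nat \<Rightarrow> 'a \<Rightarrow> nat) \<Rightarrow> int \<Rightarrow> int \<Rightarrow> 'a \<Rightarrow> int" where
  "shifted_time \<Delta> \<tau> m n \<omega> = m + int (\<tau> (nat (n - m)) (\<Delta> m \<omega>))"

definition honest :: "'a measure \<Rightarrow> (int \<Rightarrow> 'a \<Rightarrow> 'a) \<Rightarrow> (nat \<Rightarrow> 'a \<Rightarrow> nat) \<Rightarrow> bool" where
  "honest M \<Delta> \<tau> \<longleftrightarrow>
     (\<forall>m k l n. m \<le> k \<and> k \<le> l \<and> l \<le> n \<longrightarrow>
       (AE \<omega> in M. shifted_time \<Delta> \<tau> m n \<omega> \<in> {k..l} \<longrightarrow>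
          shifted_time \<Delta> \<tau> m n \<omega> = shifted_time \<Delta> \<tau> k l \<omega>))"

definition honest_splittings ::
  "'a measure \<Rightarrow> (int \<Rightarrow> int \<Rightarrow> 'a measure) \<Rightarrow> (int \<Rightarrow> 'a \<Rightarrow> 'a) \<Rightarrow> ('a \<Rightarrow> 'a) \<Rightarrow>
    (nat \<Rightarrow> 'a \<Rightarrow> nat) set" where
  "honest_splittings M F \<Delta> r = {\<tau>. symmetric_splitting M F \<Delta> r \<tau> \<and> honest M \<Delta> \<tau>}"

subsection \<open>Self-dual stopping times\<close>

text \<open>
  The filtration is indexed by \<^typ>\<open>enat\<close> so that the library's \<^const>\<open>stopping_time\<close> applies to
  times that may be infinite; the condition at \<open>\<infinity>\<close> is vacuous.
\<close>

definition forward_filtration ::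
  "'a measure \<Rightarrow> (int \<Rightarrow> int \<Rightarrow> 'a measure) \<Rightarrow> enat \<Rightarrow> 'a measure" where
  "forward_filtration M F t = (case t of enat n \<Rightarrow> F 0 (int n) | \<infinity> \<Rightarrow> F_infty M F)"

definition positive_stopping_time ::
  "'a measure \<Rightarrow> (int \<Rightarrow> int \<Rightarrow> 'a measure) \<Rightarrow> ('a \<Rightarrow> enat) \<Rightarrow> bool" where
  "positive_stopping_time M F \<gamma> \<longleftrightarrow>
     stopping_time (forward_filtration M F) \<gamma> \<and> (\<forall>\<omega>\<in>space M. 1 \<le> \<gamma> \<omega>)"

primrec iterate_time :: "(int \<Rightarrow> 'a \<Rightarrow> 'a) \<Rightarrow> ('a \<Rightarrow> enat) \<Rightarrow> nat \<Rightarrow> 'a \<Rightarrow> enat" where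
  "iterate_time \<Delta> \<gamma> 0 \<omega> = 0"
| "iterate_time \<Delta> \<gamma> (Suc n) \<omega> =
     (case iterate_time \<Delta> \<gamma> n \<omega> of
        enat k \<Rightarrow> enat k + \<gamma> (\<Delta> (int k) \<omega>)
      | \<infinity> \<Rightarrow> \<infinity>)"

definition renewal_set :: "(int \<Rightarrow> 'a \<Rightarrow> 'a) \<Rightarrow> ('a \<Rightarrow> enat) \<Rightarrow> 'a \<Rightarrow> nat set" where
  "renewal_set \<Delta> \<gamma> \<omega> = {k. \<exists>n. iterate_time \<Delta> \<gamma> n \<omega> = enat k}"

definition last_renewal :: "(int \<Rightarrow> 'a \<Rightarrow> 'a) \<Rightarrow> ('a \<Rightarrow> enat) \<Rightarrow> nat \<Rightarrow> 'a \<Rightarrow> nat" where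
  "last_renewal \<Delta> \<gamma> n \<omega> = Max ({0..n} \<inter> renewal_set \<Delta> \<gamma> \<omega>)"

definition self_dual ::
  "'a measure \<Rightarrow> (int \<Rightarrow> 'a \<Rightarrow> 'a) \<Rightarrow> ('a \<Rightarrow> 'a) \<Rightarrow> ('a \<Rightarrow> enat) \<Rightarrow> bool" where
  "self_dual M \<Delta> r \<gamma> \<longleftrightarrow>
     (\<forall>n::nat. AE \<omega> in M. n \<in> renewal_set \<Delta> \<gamma> \<omega> \<longleftrightarrow> enat n < \<gamma> (r (\<Delta> (int n) \<omega>)))"

definition self_dual_times ::
  "'a measure \<Rightarrow> (int \<Rightarrow> int \<Rightarrow> 'a measure) \<Rightarrow> (int \<Rightarrow> 'a \<Rightarrow> 'a) \<Rightarrow> ('a \<Rightarrow> 'a) \<Rightarrow>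
    ('a \<Rightarrow> enat) set" where
  "self_dual_times M F \<Delta> r = {\<gamma>. positive_stopping_time M F \<gamma> \<and> self_dual M \<Delta> r \<gamma>}"

subsection \<open>The correspondence\<close>

text \<open>The infimum of the empty set is \<open>\<infinity>\<close> in \<^typ>\<open>enat\<close>.\<close>

definition first_full :: "(nat \<Rightarrow> 'a \<Rightarrow> nat) \<Rightarrow> 'a \<Rightarrow> enat" where
  "first_full \<tau> \<omega> = Inf {enat n | n. 1 \<le> n \<and> \<tau> n \<omega> = n}"

definition AE_eq_times ::
  "'a measure \<Rightarrow> ('a \<Rightarrow> enat) set \<Rightarrow> (('a \<Rightarrow> enat) \<times> ('a \<Rightarrow> enat)) set" where
  "AE_eq_times M S = {(\<gamma>, \<gamma>'). \<gamma> \<in> S \<and> \<gamma>' \<in> S \<and> (AE \<omega> in M. \<gamma> \<omega> = \<gamma>' \<omega>)}"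

definition AE_eq_families ::
  "'a measure \<Rightarrow> (nat \<Rightarrow> 'a \<Rightarrow> nat) set \<Rightarrow> ((nat \<Rightarrow> 'a \<Rightarrow> nat) \<times> (nat \<Rightarrow> 'a \<Rightarrow> nat)) set" where
  "AE_eq_families M T =
     {(\<tau>, \<tau>'). \<tau> \<in> T \<and> \<tau>' \<in> T \<and> (\<forall>n. AE \<omega> in M. \<tau> n \<omega> = \<tau>' n \<omega>)}"

end

theory Submission
  imports Defs
begin

text \<open>
  Applying honesty to nested intervals shows that the full times \<open>{n. \<tau> n = n}\<close> of an honest
  family regenerate at each of their points, so they form the renewal set of their first positive
  element, and \<open>\<tau> n\<close> is the last of them up to \<open>n\<close>. Conversely, self-duality makes the renewal
  sets started from different integers compatible, which is honesty. In both directions the event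
  \<open>\<tau> (i + j) = i\<close> is an intersection of \<open>r (\<Delta> i) \<in> C i\<close> and \<open>j < \<gamma> (\<Delta> i)\<close> for some \<open>C i\<close> in
  \<open>F 0 i\<close>. Since past and future are independent, the joint law of the two pairs gives mass
  \<open>p (1 - p)^(i + j) P(A \<inter> C i) P(B, j < \<gamma>)\<close> to \<open>(A \<times> {i}) \<times> (B \<times> {j})\<close>.
  If \<open>C i = {i < \<gamma>}\<close> (self-duality), this is symmetric and of product form; symmetric splitting, read
  at \<open>i = 0\<close> and at \<open>j = 0\<close>, conversely forces \<open>C i = {i < \<gamma>}\<close>.
\<close>

subsection \<open>Almost sure equality and quotients\<close>

text \<open>The map on classes is written as the saturation of an image, which avoids choosing
  representatives. Since \<open>f\<close> respects the relations, this saturation is the single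
  class of \<open>f x\<close> for any representative \<open>x\<close>, and likewise for
  \<open>g\<close>; so the two lifts inherit being mutually inverse.\<close>

lemma bij_betw_quotients:
  assumes R: "equiv S R" and Q: "equiv T Q"
    and f: "\<And>x. x \<in> S \<Longrightarrow> f x \<in> T" and g: "\<And>y. y \<in> T \<Longrightarrow> g y \<in> S"
    and f_cong: "\<And>x x'. (x, x') \<in> R \<Longrightarrow> (f x, f x') \<in> Q"
    and g_cong: "\<And>y y'. (y, y') \<in> Q \<Longrightarrow> (g y, g y') \<in> R"
    and gf: "\<And>x. x \<in> S \<Longrightarrow> (g (f x), x) \<in> R"
    and fg: "\<And>y. y \<in> T \<Longrightarrow> (f (g y), y) \<in> Q"
  shows "bij_betw (\<lambda>C. Q `` (f ` C)) (S // R) (T // Q)"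
proof -
  have lift: "Q `` (f ` (R `` {x})) = Q `` {f x}" if "x \<in> S" for x
  proof -
    have "Q `` (f ` (R `` {x})) = (\<Union>x'\<in>R `` {x}. Q `` {f x'})" by blast
    also have "\<dots> = (\<Union>x'\<in>R `` {x}. Q `` {f x})"
      using equiv_class_eq[OF Q f_cong] by (intro SUP_cong) auto
    also have "\<dots> = Q `` {f x}"
      using equiv_class_self[OF R that] by blast
    finally show ?thesis .
  qed
  have unlift: "R `` (g ` (Q `` {y})) = R `` {g y}" if "y \<in> T" for y
  proof -
    have "R `` (g ` (Q `` {y})) = (\<Union>y'\<in>Q `` {y}. R `` {g y'})" by blast
    also have "\<dots> = (\<Union>y'\<in>Q `` {y}. R `` {g y})"
      using equiv_class_eq[OF R g_cong] by (intro SUP_cong) auto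
    also have "\<dots> = R `` {g y}"
      using equiv_class_self[OF Q that] by blast
    finally show ?thesis .
  qed
  show ?thesis
  proof (rule bij_betw_byWitness[where f' = "\<lambda>D. R `` (g ` D)"])
    show "\<forall>C\<in>S // R. R `` (g ` (Q `` (f ` C))) = C"
    proof
      fix C assume "C \<in> S // R"
      then obtain x where "x \<in> S" "C = R `` {x}" by (rule quotientE)
      then show "R `` (g ` (Q `` (f ` C))) = C"
        using equiv_class_eq[OF R gf] by (simp only: lift unlift f)
    qed
    show "\<forall>D\<in>T // Q. Q `` (f ` (R `` (g ` D))) = D"
    proof
      fix D assume "D \<in> T // Q"
      then obtain y where "y \<in> T" "D = Q `` {y}" by (rule quotientE)
      then show "Q `` (f ` (R `` (g ` D))) = D"
        using equiv_class_eq[OF Q fg] by (simp only: lift unlift g)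
    qed
    show "(\<lambda>C. Q `` (f ` C)) ` (S // R) \<subseteq> T // Q"
    proof (clarify elim!: quotientE)
      fix x assume "x \<in> S"
      then show "Q `` f ` R `` {x} \<in> T // Q"
        using quotientI[OF f, of x Q] by (simp only: lift)
    qed
    show "(\<lambda>D. R `` (g ` D)) ` (T // Q) \<subseteq> S // R"
    proof (clarify elim!: quotientE)
      fix y assume "y \<in> T"
      then show "R `` g ` Q `` {y} \<in> S // R"
        using quotientI[OF g, of y R] by (simp only: unlift)
    qed
  qed
qed

lemma AE_eq_trans:
  assumes "AE x in M. a x = b x" "AE x in M. b x = c x"
  shows "AE x in M. a x = c x"
  using assms by eventually_elim simp

lemma AE_eq_sym:
  assumes "AE x in M. a x = b x"
  shows "AE x in M. b x = a x"
  using assms by eventually_elim simp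

lemma equiv_AE_eq_times: "equiv S (AE_eq_times M S)"
proof (intro equivI symI transI)
  show "AE_eq_times M S \<subseteq> S \<times> S" "refl_on S (AE_eq_times M S)"
    by (auto simp: AE_eq_times_def refl_on_def)
next
  fix a b assume "(a, b) \<in> AE_eq_times M S"
  then show "(b, a) \<in> AE_eq_times M S"
    unfolding AE_eq_times_def mem_Collect_eq case_prod_conv using AE_eq_sym[of a b M] by blast
next
  fix a b c assume "(a, b) \<in> AE_eq_times M S" "(b, c) \<in> AE_eq_times M S"
  then show "(a, c) \<in> AE_eq_times M S"
    unfolding AE_eq_times_def mem_Collect_eq case_prod_conv using AE_eq_trans[of a b M c] by blast
qed

lemma equiv_AE_eq_families: "equiv T (AE_eq_families M T)"
proof (intro equivI symI transI)
  show "AE_eq_families M T \<subseteq> T \<times> T" "refl_on T (AE_eq_families M T)"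
    by (auto simp: AE_eq_families_def refl_on_def)
next
  fix a b assume "(a, b) \<in> AE_eq_families M T"
  then have "a \<in> T" "b \<in> T" "AE \<omega> in M. a n \<omega> = b n \<omega>" for n
    by (auto simp: AE_eq_families_def)
  then show "(b, a) \<in> AE_eq_families M T"
    unfolding AE_eq_families_def by (intro CollectI case_prodI conjI allI) (auto intro: AE_eq_sym)
next
  fix a b c assume "(a, b) \<in> AE_eq_families M T" "(b, c) \<in> AE_eq_families M T"
  then have "a \<in> T" "c \<in> T" and ae: "AE \<omega> in M. a n \<omega> = b n \<omega>" "AE \<omega> in M. b n \<omega> = c n \<omega>" for n
    by (auto simp: AE_eq_families_def)
  then show "(a, c) \<in> AE_eq_families M T"
    unfolding AE_eq_families_def
    by (intro CollectI case_prodI conjI allI AE_eq_trans[OF ae]) auto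
qed

text \<open>Testing with \<open>C\<close> and with \<open>G\<close> shows that \<open>C\<close>,
  \<open>G\<close> and \<open>C \<inter> G\<close> have the same probability, so both differences
  are null.\<close>

lemma (in prob_space) AE_eq_of_prob_Int:
  assumes "C \<in> sets N" "G \<in> sets N" "sets N \<subseteq> sets M"
    and eq: "\<And>A. A \<in> sets N \<Longrightarrow> prob (A \<inter> C) = prob (A \<inter> G)"
  shows "AE \<omega> in M. \<omega> \<in> C \<longleftrightarrow> \<omega> \<in> G"
proof -
  have "AE \<omega> in M. \<omega> \<notin> A - B" if "A \<in> sets N" "B \<in> sets N" "prob (A \<inter> B) = prob A" for A B
  proof -
    have sets: "A \<in> sets M" "B \<in> sets M" using that assms(3) by auto
    then have "prob (A - B) = 0"
      using finite_measure_Diff'[of A B] that by simp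
    then have "A - B \<in> null_sets M"
      using sets by (simp add: null_sets_def emeasure_eq_measure)
    then show ?thesis by (rule AE_not_in)
  qed
  from this[of C G] this[of G C] have "AE \<omega> in M. \<omega> \<notin> C - G" "AE \<omega> in M. \<omega> \<notin> G - C"
    using assms(1,2) eq[of C] eq[of G] by (auto simp: Int_commute)
  then show ?thesis by eventually_elim blast
qed

lemma first_full_cong_AE:
  assumes "\<And>n. AE \<omega> in M. \<tau> n \<omega> = \<tau>' n \<omega>"
  shows "AE \<omega> in M. first_full \<tau> \<omega> = first_full \<tau>' \<omega>"
proof -
  have "AE \<omega> in M. \<forall>n. \<tau> n \<omega> = \<tau>' n \<omega>"
    unfolding AE_all_countable using assms by blast
  then show ?thesis by eventually_elim (simp add: first_full_def)
qed

subsection \<open>Renewal sets and noises\<close>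

lemma iterate_time_mono:
  "a \<le> b \<Longrightarrow> iterate_time \<Delta> \<gamma> a \<omega> \<le> iterate_time \<Delta> \<gamma> b \<omega>"
proof (induction b rule: nat_induct_at_least)
  case (Suc b)
  then show ?case
    by (cases "iterate_time \<Delta> \<gamma> b \<omega>") (auto intro: order_trans)
qed simp

lemma zero_in_renewal_set: "0 \<in> renewal_set \<Delta> \<gamma> \<omega>"
  by (auto simp: renewal_set_def zero_enat_def intro!: exI[of _ 0])

lemma last_renewal_eq_iff:
  "last_renewal \<Delta> \<gamma> n \<omega> = i \<longleftrightarrow>
     i \<in> renewal_set \<Delta> \<gamma> \<omega> \<and> i \<le> n \<and> (\<forall>k \<in> renewal_set \<Delta> \<gamma> \<omega>. k \<le> n \<longrightarrow> k \<le> i)"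
proof -
  \<comment> \<open>Time 0 is always a renewal, so \<open>Max\<close> is taken over a nonempty
    finite set and is a true maximum.\<close>
  have "{0..n} \<inter> renewal_set \<Delta> \<gamma> \<omega> \<noteq> {}"
    using zero_in_renewal_set[of \<Delta> \<gamma> \<omega>] by force
  then show ?thesis
    unfolding last_renewal_def by (subst Max_eq_iff) auto
qed

lemma last_renewal_le: "last_renewal \<Delta> \<gamma> n \<omega> \<le> n"
  using last_renewal_eq_iff[of \<Delta> \<gamma> n \<omega>] by blast

lemma last_renewal_full_iff: "last_renewal \<Delta> \<gamma> n \<omega> = n \<longleftrightarrow> n \<in> renewal_set \<Delta> \<gamma> \<omega>"
  by (auto simp: last_renewal_eq_iff)

lemma first_full_le_iff: "first_full \<tau> \<omega> \<le> enat n \<longleftrightarrow> (\<exists>k\<in>{1..n}. \<tau> k \<omega> = k)"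
proof
  assume "\<exists>k\<in>{1..n}. \<tau> k \<omega> = k"
  then obtain k where "1 \<le> k" "k \<le> n" "\<tau> k \<omega> = k" by auto
  then have "first_full \<tau> \<omega> \<le> enat k"
    unfolding first_full_def by (intro Inf_lower) blast
  also have "\<dots> \<le> enat n" using \<open>k \<le> n\<close> by simp
  finally show "first_full \<tau> \<omega> \<le> enat n" .
next
  let ?A = "{enat n | n. 1 \<le> n \<and> \<tau> n \<omega> = n}"
  assume *: "first_full \<tau> \<omega> \<le> enat n"
  \<comment> \<open>A bound on the infimum yields a member of the set: if every member were at least
    \<open>Suc n\<close>, so would be the infimum. This covers the empty set, whose infimum is
    \<open>\<infinity>\<close>.\<close>
  have "\<exists>x\<in>?A. x < enat (Suc n)"
  proof (rule ccontr)
    assume "\<not> ?thesis"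
    then have "enat (Suc n) \<le> first_full \<tau> \<omega>"
      unfolding first_full_def by (intro Inf_greatest) (force simp: not_less)
    also note *
    finally show False by simp
  qed
  then show "\<exists>k\<in>{1..n}. \<tau> k \<omega> = k"
    by force
qed

lemma first_full_ge_1: "1 \<le> first_full \<tau> \<omega>"
proof -
  have "\<not> first_full \<tau> \<omega> \<le> enat 0" unfolding first_full_le_iff by simp
  then show ?thesis by (simp add: zero_enat_def[symmetric] one_eSuc ileI1 flip: not_le)
qed

lemma first_full_full:
  assumes "first_full \<tau> \<omega> = enat n"
  shows "\<tau> n \<omega> = n"
proof -
  obtain k where k: "k \<in> {1..n}" "\<tau> k \<omega> = k"
    using first_full_le_iff[of \<tau> \<omega> n] assms by auto
  then have "first_full \<tau> \<omega> \<le> enat k"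
    unfolding first_full_le_iff by force
  then have "k = n" using assms k(1) by simp
  then show ?thesis using k(2) by blast
qed

lemma enat_eqI_le:
  fixes x y :: enat
  assumes "\<And>n. x \<le> enat n \<longleftrightarrow> y \<le> enat n"
  shows "x = y"
proof (rule order_antisym)
  show "x \<le> y" using assms by (cases y) auto
  show "y \<le> x" using assms by (cases x) auto
qed

section \<open>Elementary properties of the sigma-fields and shifts of a noise\<close>

context noise
begin

lemma space_F: "m \<le> n \<Longrightarrow> space (F m n) = space M"
  using subalgebra_F by (auto simp: subalgebra_def)

lemma sets_F_subset: "m \<le> n \<Longrightarrow> sets (F m n) \<subseteq> sets M"
  using subalgebra_F by (auto simp: subalgebra_def)

text \<open>The field of an interval is generated by the fields of its two parts; one use moves the
  left endpoint from \<open>m\<close> to \<open>k\<close>, a second moves the right endpoint from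
  \<open>n\<close> to \<open>l\<close>.\<close>

lemma sets_F_mono:
  assumes "k \<le> m" "m \<le> n" "n \<le> l"
  shows "sets (F m n) \<subseteq> sets (F k l)"
proof -
  have "sets (F m n) \<subseteq> sets (F k n)"
    using join_F[of k m n] assms by (metis Un_subset_iff sigma_sets_superset_generator)
  also have "\<dots> \<subseteq> sets (F k l)"
    using join_F[of k n l] assms by (metis Un_subset_iff order_trans sigma_sets_superset_generator)
  finally show ?thesis .
qed

lemma shift_vimage:
  assumes "m \<le> n" "A \<in> sets (F m n)"
  shows "\<Delta> h -` A \<inter> space M \<in> sets (F (m + h) (n + h))"
  using shift_F[OF assms(1), of h] assms(2) by blast

lemma shift_in_space: "\<omega> \<in> space M \<Longrightarrow> \<Delta> h \<omega> \<in> space M"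
  by (rule measurable_space[OF shift_measurable])

lemma AE_shift: "AE \<omega> in M. P \<omega> \<Longrightarrow> AE \<omega> in M. P (\<Delta> h \<omega>)"
  using AE_distrD[OF shift_measurable, of P h] unfolding shift_preserving .

lemma prob_shift: "A \<in> sets M \<Longrightarrow> prob (\<Delta> h -` A \<inter> space M) = prob A"
  using measure_distr[OF shift_measurable, of A h] by (simp add: shift_preserving)

lemma space_F_infty: "space (F_infty M F) = space M"
  by (simp add: F_infty_def space_measure_of_conv)

lemma sets_F_infty:
  "sets (F_infty M F) = sigma_sets (space M) (\<Union>n::nat. sets (F 0 (int n)))"
proof -
  have "(\<Union>n::nat. sets (F 0 (int n))) \<subseteq> Pow (space M)"
    using sets_F_subset[of 0] sets.space_closed[of M] by (intro UN_least) (metis of_nat_0_le_iff order_trans)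
  then show ?thesis
    unfolding F_infty_def by (rule sets_measure_of)
qed

lemma sets_F_infty_subset: "sets (F_infty M F) \<subseteq> sets M"
  unfolding sets_F_infty using sets_F_subset[of 0] by (intro sets.sigma_sets_subset UN_least) simp

lemma F_in_F_infty: "A \<in> sets (F 0 (int n)) \<Longrightarrow> A \<in> sets (F_infty M F)"
  unfolding sets_F_infty by (rule sigma_sets.Basic) blast

lemma measurable_F_infty: "f \<in> N \<rightarrow>\<^sub>M M \<Longrightarrow> f \<in> N \<rightarrow>\<^sub>M F_infty M F"
  using measurable_mono[of "F_infty M F" M N N] sets_F_infty_subset space_F_infty by auto

text \<open>For growing intervals any two events lie in one field of the family. This makes the
  unions pi-systems, so that independence extends to the sigma-fields they generate.\<close>

lemma Int_stable_UN_F: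
  assumes "\<And>n::nat. f n \<le> g n" and "\<And>n m. n \<le> m \<Longrightarrow> f m \<le> f n \<and> g n \<le> g m"
  shows "Int_stable (\<Union>n::nat. sets (F (f n) (g n)))"
proof (intro Int_stableI)
  fix A B
  assume "A \<in> (\<Union>n. sets (F (f n) (g n)))" "B \<in> (\<Union>n. sets (F (f n) (g n)))"
  then obtain i j where ij: "A \<in> sets (F (f i) (g i))" "B \<in> sets (F (f j) (g j))" by blast
  define k where "k = max i j"
  have "sets (F (f i) (g i)) \<subseteq> sets (F (f k) (g k))" "sets (F (f j) (g j)) \<subseteq> sets (F (f k) (g k))"
    using assms(1) assms(2)[of i k] assms(2)[of j k] by (intro sets_F_mono; simp add: k_def)+
  then have "A \<inter> B \<in> sets (F (f k) (g k))"
    using ij by (intro sets.Int) auto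
  then show "A \<inter> B \<in> (\<Union>n. sets (F (f n) (g n)))" by blast
qed

section \<open>Regeneration of renewal sets\<close>

lemma iterate_time_add:
  assumes "\<omega> \<in> space M" "iterate_time \<Delta> \<gamma> a \<omega> = enat k"
  shows "iterate_time \<Delta> \<gamma> (a + b) \<omega> = enat k + iterate_time \<Delta> \<gamma> b (\<Delta> (int k) \<omega>)"
proof (induction b)
  case (Suc b)
  show ?case
  proof (cases "iterate_time \<Delta> \<gamma> b (\<Delta> (int k) \<omega>)")
    case (enat q)
    \<comment> \<open>If the restarted walk stands at \<open>q\<close>, the original one stands at
      \<open>k + q\<close>, and the group law of the shifts identifies their next
      increments.\<close>
    then show ?thesis
      using Suc shift_add[OF assms(1), of "int q" "int k"]
      by (simp add: add.commute[of "int k"] flip: add.assoc plus_enat_simps(1)) (simp add: add.commute)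
  qed (use Suc in simp)
qed (use assms in \<open>simp add: zero_enat_def\<close>)

text \<open>The iteration restarts at each renewal time, so the later renewals seen from
  \<open>k\<close> are those of the shifted path.\<close>

lemma renewal_set_shift:
  assumes "\<omega> \<in> space M" "k \<in> renewal_set \<Delta> \<gamma> \<omega>"
  shows "k + n \<in> renewal_set \<Delta> \<gamma> \<omega> \<longleftrightarrow> n \<in> renewal_set \<Delta> \<gamma> (\<Delta> (int k) \<omega>)"
proof
  obtain a where a: "iterate_time \<Delta> \<gamma> a \<omega> = enat k"
    using assms(2) by (auto simp: renewal_set_def)
  note add = iterate_time_add[OF assms(1) a]
  {
    assume "n \<in> renewal_set \<Delta> \<gamma> (\<Delta> (int k) \<omega>)"
    then obtain b where "iterate_time \<Delta> \<gamma> b (\<Delta> (int k) \<omega>) = enat n"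
      by (auto simp: renewal_set_def)
    then have "iterate_time \<Delta> \<gamma> (a + b) \<omega> = enat (k + n)"
      using add by simp
    then show "k + n \<in> renewal_set \<Delta> \<gamma> \<omega>"
      unfolding renewal_set_def by blast
  next
    assume "k + n \<in> renewal_set \<Delta> \<gamma> \<omega>"
    then obtain c where c: "iterate_time \<Delta> \<gamma> c \<omega> = enat (k + n)"
      by (auto simp: renewal_set_def)
    show "n \<in> renewal_set \<Delta> \<gamma> (\<Delta> (int k) \<omega>)"
    proof (cases "a \<le> c")
      case True
      then obtain b where "c = a + b" using le_Suc_ex by blast
      then have "enat k + iterate_time \<Delta> \<gamma> b (\<Delta> (int k) \<omega>) = enat (k + n)"
        using add c by simp
      then have "iterate_time \<Delta> \<gamma> b (\<Delta> (int k) \<omega>) = enat n"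
        by (cases "iterate_time \<Delta> \<gamma> b (\<Delta> (int k) \<omega>)") auto
      then show ?thesis unfolding renewal_set_def by blast
    next
      case False
      \<comment> \<open>An index below \<open>a\<close> gives a time at most \<open>k\<close> by
        monotonicity, while the time is \<open>k + n\<close>.\<close>
      then have "n = 0"
        using iterate_time_mono[of c a \<Delta> \<gamma> \<omega>] a c by simp
      then show ?thesis by (simp add: zero_in_renewal_set)
    qed
  }
qed

lemma iterate_time_1: "\<omega> \<in> space M \<Longrightarrow> iterate_time \<Delta> \<gamma> 1 \<omega> = \<gamma> \<omega>"
  by (simp add: zero_enat_def[symmetric] shift_zero) (simp add: zero_enat_def shift_zero)

lemma time_in_renewal_set:
  assumes "\<omega> \<in> space M" "\<gamma> \<omega> = enat n"
  shows "n \<in> renewal_set \<Delta> \<gamma> \<omega>"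
  using iterate_time_1[OF assms(1), of \<gamma>] assms(2) unfolding renewal_set_def by (intro CollectI exI[of _ 1]) (rule trans)

lemma renewal_set_ge:
  assumes "\<omega> \<in> space M" "n \<in> renewal_set \<Delta> \<gamma> \<omega>" "0 < n"
  shows "\<gamma> \<omega> \<le> enat n"
proof -
  obtain a where a: "iterate_time \<Delta> \<gamma> a \<omega> = enat n"
    using assms(2) by (auto simp: renewal_set_def)
  \<comment> \<open>The iterate of index 0 is 0, so a positive renewal needs at least one step, and
    the first step is \<open>\<gamma>\<close>.\<close>
  then have "1 \<le> a" using assms(3) by (cases a) (auto simp: zero_enat_def)
  then have "iterate_time \<Delta> \<gamma> 1 \<omega> \<le> enat n"
    using iterate_time_mono[of 1 a \<Delta> \<gamma> \<omega>] a by simp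
  then show ?thesis using iterate_time_1[OF assms(1)] by metis
qed

text \<open>After a renewal at \<open>i\<close> the next one comes after a wait of
  \<open>\<gamma> (\<Delta> (int i) \<omega>)\<close>, so \<open>i\<close> is the last one up to
  \<open>i + j\<close> exactly when this wait exceeds \<open>j\<close>. The lower bound on
  \<open>\<gamma>\<close> is stated on the whole space because it is applied to the shifted
  path.\<close>

lemma last_renewal_split:
  assumes "\<omega> \<in> space M" "\<And>\<omega>. \<omega> \<in> space M \<Longrightarrow> 1 \<le> \<gamma> \<omega>"
  shows "last_renewal \<Delta> \<gamma> (i + j) \<omega> = i \<longleftrightarrow>
    i \<in> renewal_set \<Delta> \<gamma> \<omega> \<and> enat j < \<gamma> (\<Delta> (int i) \<omega>)"
proof (cases "i \<in> renewal_set \<Delta> \<gamma> \<omega>")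
  case True
  note shift = renewal_set_shift[OF assms(1) True]
  have sp: "\<Delta> (int i) \<omega> \<in> space M" using assms(1) by (rule shift_in_space)
  have "(\<forall>k \<in> renewal_set \<Delta> \<gamma> \<omega>. k \<le> i + j \<longrightarrow> k \<le> i) \<longleftrightarrow> enat j < \<gamma> (\<Delta> (int i) \<omega>)"
  proof
    assume *: "\<forall>k \<in> renewal_set \<Delta> \<gamma> \<omega>. k \<le> i + j \<longrightarrow> k \<le> i"
    show "enat j < \<gamma> (\<Delta> (int i) \<omega>)"
    proof (rule ccontr)
      assume "\<not> enat j < \<gamma> (\<Delta> (int i) \<omega>)"
      then obtain n where n: "\<gamma> (\<Delta> (int i) \<omega>) = enat n" "n \<le> j"
        by (cases "\<gamma> (\<Delta> (int i) \<omega>)") auto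
      then have "i + n \<in> renewal_set \<Delta> \<gamma> \<omega>"
        using time_in_renewal_set[where \<gamma> = \<gamma>, OF sp n(1)] shift by blast
      \<comment> \<open>A renewal at \<open>i + n\<close> with \<open>n \<le> j\<close> is at most
        \<open>i\<close>, so the wait would be 0, against \<open>1 \<le> \<gamma>\<close>.\<close>
      then have "n = 0" using * n(2) by fastforce
      then show False using assms(2)[OF sp] n(1) by (simp add: one_enat_def)
    qed
  next
    assume *: "enat j < \<gamma> (\<Delta> (int i) \<omega>)"
    show "\<forall>k \<in> renewal_set \<Delta> \<gamma> \<omega>. k \<le> i + j \<longrightarrow> k \<le> i"
    proof (intro ballI impI, rule ccontr)
      fix k assume k: "k \<in> renewal_set \<Delta> \<gamma> \<omega>" "k \<le> i + j" "\<not> k \<le> i"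
      then have "k - i \<in> renewal_set \<Delta> \<gamma> (\<Delta> (int i) \<omega>)"
        using shift[of "k - i"] by simp
      then have "\<gamma> (\<Delta> (int i) \<omega>) \<le> enat (k - i)"
        using renewal_set_ge[OF sp] k by simp
      also have "\<dots> \<le> enat j" using k by simp
      finally show False using * by simp
    qed
  qed
  then show ?thesis using True by (simp add: last_renewal_eq_iff)
qed (simp add: last_renewal_eq_iff)

text \<open>The full times of \<open>last_renewal\<close> are the renewals, and the first positive
  renewal is \<open>\<gamma>\<close> itself; no null set enters.\<close>

lemma first_full_last_renewal:
  assumes \<omega>: "\<omega> \<in> space M" and "1 \<le> \<gamma> \<omega>"
  shows "first_full (last_renewal \<Delta> \<gamma>) \<omega> = \<gamma> \<omega>"
proof (rule enat_eqI_le)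
  fix n
  have "(\<exists>k\<in>{1..n}. k \<in> renewal_set \<Delta> \<gamma> \<omega>) \<longleftrightarrow> \<gamma> \<omega> \<le> enat n"
  proof
    assume "\<exists>k\<in>{1..n}. k \<in> renewal_set \<Delta> \<gamma> \<omega>"
    then show "\<gamma> \<omega> \<le> enat n"
    proof
      fix k assume k: "k \<in> {1..n}" "k \<in> renewal_set \<Delta> \<gamma> \<omega>"
      then have "\<gamma> \<omega> \<le> enat k" by (intro renewal_set_ge[OF \<omega>]) auto
      also have "\<dots> \<le> enat n" using k by simp
      finally show ?thesis .
    qed
  next
    assume "\<gamma> \<omega> \<le> enat n"
    then obtain k where "\<gamma> \<omega> = enat k" "k \<le> n" by (cases "\<gamma> \<omega>") auto
    then show "\<exists>k\<in>{1..n}. k \<in> renewal_set \<Delta> \<gamma> \<omega>"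
      using time_in_renewal_set[OF \<omega>] assms(2) by (force simp: one_enat_def)
  qed
  then show "first_full (last_renewal \<Delta> \<gamma>) \<omega> \<le> enat n \<longleftrightarrow> \<gamma> \<omega> \<le> enat n"
    by (simp add: first_full_le_iff last_renewal_full_iff)
qed

text \<open>The iterates evaluate \<open>\<gamma>\<close> along the whole orbit; the shifts preserve
  \<open>M\<close> and are countably many, so one null set serves all of them.\<close>

lemma last_renewal_cong_AE:
  assumes "AE \<omega> in M. \<gamma> \<omega> = \<gamma>' \<omega>"
  shows "AE \<omega> in M. last_renewal \<Delta> \<gamma> n \<omega> = last_renewal \<Delta> \<gamma>' n \<omega>"
proof -
  have "AE \<omega> in M. \<forall>k. \<gamma> (\<Delta> k \<omega>) = \<gamma>' (\<Delta> k \<omega>)"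
    unfolding AE_all_countable using AE_shift[OF assms] by blast
  then show ?thesis
  proof eventually_elim
    case (elim \<omega>)
    have "iterate_time \<Delta> \<gamma> k \<omega> = iterate_time \<Delta> \<gamma>' k \<omega>" for k
      by (induction k) (simp_all add: elim split: enat.split)
    then show ?case by (simp add: last_renewal_def renewal_set_def)
  qed
qed

section \<open>Measurability of stopping times, renewal sets and last renewals\<close>

lemma stopping_time_le:
  assumes "positive_stopping_time M F \<gamma>"
  shows "{\<omega> \<in> space M. \<gamma> \<omega> \<le> enat n} \<in> sets (F 0 (int n))"
proof -
  have "Measurable.pred (forward_filtration M F (enat n)) (\<lambda>\<omega>. \<gamma> \<omega> \<le> enat n)"
    using assms unfolding positive_stopping_time_def stopping_time_def by blast
  then show ?thesis
    by (simp add: forward_filtration_def pred_def space_F)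
qed

lemma stopping_time_exceeds:
  assumes "positive_stopping_time M F \<gamma>"
  shows "{\<omega> \<in> space M. enat n < \<gamma> \<omega>} \<in> sets (F_infty M F)"
proof -
  have "{\<omega> \<in> space M. enat n < \<gamma> \<omega>} = space (F_infty M F) - {\<omega> \<in> space M. \<gamma> \<omega> \<le> enat n}"
    by (auto simp: space_F_infty)
  then show ?thesis
    using F_in_F_infty[OF stopping_time_le[OF assms]] by auto
qed

lemma stopping_time_equals:
  assumes "positive_stopping_time M F \<gamma>"
  shows "{\<omega> \<in> space M. \<gamma> \<omega> = enat n} \<in> sets (F 0 (int n))"
proof -
  have le: "{\<omega> \<in> space M. \<gamma> \<omega> \<le> enat k} \<in> sets (F 0 (int n))" if "k \<le> n" for k
    using stopping_time_le[OF assms, of k] sets_F_mono[of 0 0 "int k" "int n"] that by auto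
  have "{\<omega> \<in> space M. \<gamma> \<omega> = enat n} =
      {\<omega> \<in> space M. \<gamma> \<omega> \<le> enat n} - (\<Union>k\<in>{..<n}. {\<omega> \<in> space M. \<gamma> \<omega> \<le> enat k})"
  proof (intro set_eqI iffI)
    fix \<omega> assume "\<omega> \<in> {\<omega> \<in> space M. \<gamma> \<omega> \<le> enat n} - (\<Union>k\<in>{..<n}. {\<omega> \<in> space M. \<gamma> \<omega> \<le> enat k})"
    then show "\<omega> \<in> {\<omega> \<in> space M. \<gamma> \<omega> = enat n}"
      by (cases "\<gamma> \<omega>") (auto simp: not_le intro: antisym)
  qed auto
  also have "\<dots> \<in> sets (F 0 (int n))"
    using le by (intro sets.Diff sets.finite_UN) auto
  finally show ?thesis .
qed

text \<open>Decompose by the value \<open>m \<le> n\<close> of the preceding iterate: reaching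
  \<open>m\<close> is known at time \<open>m\<close>, and by shift covariance a wait of
  \<open>n - m\<close> from there belongs to the field of the interval from \<open>m\<close> to
  \<open>n\<close>. Both fields lie in \<open>F 0 (int n)\<close>.\<close>

lemma renewal_set_measurable:
  assumes "positive_stopping_time M F \<gamma>"
  shows "{\<omega> \<in> space M. n \<in> renewal_set \<Delta> \<gamma> \<omega>} \<in> sets (F 0 (int n))"
proof -
  have "{\<omega> \<in> space M. iterate_time \<Delta> \<gamma> k \<omega> = enat n} \<in> sets (F 0 (int n))" for k
  proof (induction k arbitrary: n)
    case 0
    have "{} \<in> sets (F 0 (int n))" "space M \<in> sets (F 0 (int n))"
      using sets.top[of "F 0 (int n)"] space_F[of 0 "int n"] by auto
    then show ?case by (cases n) (auto simp: zero_enat_def)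
  next
    case (Suc k)
    have "{\<omega> \<in> space M. iterate_time \<Delta> \<gamma> (Suc k) \<omega> = enat n} =
      (\<Union>m\<in>{..n}. {\<omega> \<in> space M. iterate_time \<Delta> \<gamma> k \<omega> = enat m} \<inter>
        (\<Delta> (int m) -` {\<omega> \<in> space M. \<gamma> \<omega> = enat (n - m)} \<inter> space M))" (is "?L = ?R")
    proof (intro set_eqI iffI)
      fix \<omega> assume *: "\<omega> \<in> ?L"
      then obtain m where m: "iterate_time \<Delta> \<gamma> k \<omega> = enat m" "enat m + \<gamma> (\<Delta> (int m) \<omega>) = enat n"
        by (auto split: enat.splits)
      then obtain q where "\<gamma> (\<Delta> (int m) \<omega>) = enat q" by (cases "\<gamma> (\<Delta> (int m) \<omega>)") auto
      then show "\<omega> \<in> ?R" using * m shift_in_space by (auto intro!: bexI[of _ m])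
    qed auto
    also have "\<dots> \<in> sets (F 0 (int n))"
    proof (rule sets.finite_UN[OF finite_atMost], rule sets.Int)
      fix m assume "m \<in> {..n}"
      then show "{\<omega> \<in> space M. iterate_time \<Delta> \<gamma> k \<omega> = enat m} \<in> sets (F 0 (int n))"
        using Suc[of m] sets_F_mono[of 0 0 "int m" "int n"] by auto
      have "\<Delta> (int m) -` {\<omega> \<in> space M. \<gamma> \<omega> = enat (n - m)} \<inter> space M \<in> sets (F (int m) (int n))"
        using shift_vimage[OF _ stopping_time_equals[OF assms], of "n - m" "int m"] \<open>m \<in> {..n}\<close>
        by (simp add: of_nat_diff)
      then show "\<Delta> (int m) -` {\<omega> \<in> space M. \<gamma> \<omega> = enat (n - m)} \<inter> space M \<in> sets (F 0 (int n))"
        using sets_F_mono[of 0 "int m" "int n" "int n"] \<open>m \<in> {..n}\<close> by auto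
    qed
    finally show ?case .
  qed
  then have "(\<Union>k. {\<omega> \<in> space M. iterate_time \<Delta> \<gamma> k \<omega> = enat n}) \<in> sets (F 0 (int n))"
    by (intro sets.countable_UN) auto
  also have "(\<Union>k. {\<omega> \<in> space M. iterate_time \<Delta> \<gamma> k \<omega> = enat n}) = {\<omega> \<in> space M. n \<in> renewal_set \<Delta> \<gamma> \<omega>}"
    by (auto simp: renewal_set_def)
  finally show ?thesis .
qed

lemma random_index_family_last_renewal:
  assumes "positive_stopping_time M F \<gamma>"
  shows "random_index_family F (last_renewal \<Delta> \<gamma>)"
  unfolding random_index_family_def measurable_count_space_eq2[OF finite_atLeastAtMost]
proof (intro allI conjI ballI)
  fix n
  show "last_renewal \<Delta> \<gamma> n \<in> space (F 0 (int n)) \<rightarrow> {0..n}"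
    using last_renewal_le by auto
  fix i assume i: "i \<in> {0..n}"
  have *: "{\<omega> \<in> space M. k \<in> renewal_set \<Delta> \<gamma> \<omega>} \<in> sets (F 0 (int n))" if "k \<le> n" for k
    using renewal_set_measurable[OF assms, of k] sets_F_mono[of 0 0 "int k" "int n"] that by auto
  have "last_renewal \<Delta> \<gamma> n -` {i} \<inter> space (F 0 (int n)) =
      {\<omega> \<in> space M. i \<in> renewal_set \<Delta> \<gamma> \<omega>} - (\<Union>k\<in>{i<..n}. {\<omega> \<in> space M. k \<in> renewal_set \<Delta> \<gamma> \<omega>})"
    using i last_renewal_eq_iff[of \<Delta> \<gamma> n _ i] space_F[of 0 "int n"]
    by (intro set_eqI) (force simp: not_less)
  also have "\<dots> \<in> sets (F 0 (int n))"
    using i by (intro sets.Diff sets.finite_UN *) auto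
  finally show "last_renewal \<Delta> \<gamma> n -` {i} \<inter> space (F 0 (int n)) \<in> sets (F 0 (int n))" .
qed

lemma positive_stopping_time_first_full:
  assumes "random_index_family F \<tau>"
  shows "positive_stopping_time M F (first_full \<tau>)"
  unfolding positive_stopping_time_def stopping_time_def
proof (intro conjI allI ballI first_full_ge_1)
  fix t
  show "Measurable.pred (forward_filtration M F t) (\<lambda>\<omega>. first_full \<tau> \<omega> \<le> t)"
  proof (cases t)
    case (enat n)
    have "\<tau> k -` {k} \<inter> space (F 0 (int k)) \<in> sets (F 0 (int n))" if "k \<in> {1..n}" for k
    proof -
      have "\<tau> k -` {k} \<inter> space (F 0 (int k)) \<in> sets (F 0 (int k))"
        using assms by (intro measurable_sets[of _ _ "count_space {0..k}"]) (auto simp: random_index_family_def)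
      then show ?thesis
        using that sets_F_mono[of 0 0 "int k" "int n"] by auto
    qed
    then have "(\<Union>k\<in>{1..n}. \<tau> k -` {k} \<inter> space (F 0 (int k))) \<in> sets (F 0 (int n))"
      by blast
    also have "(\<Union>k\<in>{1..n}. \<tau> k -` {k} \<inter> space (F 0 (int k))) =
        {\<omega> \<in> space (F 0 (int n)). \<exists>k\<in>{1..n}. \<tau> k \<omega> = k}"
      by (auto simp: space_F)
    finally have "Measurable.pred (F 0 (int n)) (\<lambda>\<omega>. \<exists>k\<in>{1..n}. \<tau> k \<omega> = k)"
      by (simp add: pred_def)
    then show ?thesis by (simp add: enat forward_filtration_def first_full_le_iff)
  qed simp
qed

lemma random_index_family_measurable:
  assumes "random_index_family F \<tau>"
  shows "\<tau> n \<in> M \<rightarrow>\<^sub>M count_space UNIV" "\<omega> \<in> space M \<Longrightarrow> \<tau> n \<omega> \<le> n"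
proof -
  have n: "\<tau> n \<in> F 0 (int n) \<rightarrow>\<^sub>M count_space {0..n}"
    using assms unfolding random_index_family_def by blast
  have "\<tau> n \<in> F 0 (int n) \<rightarrow>\<^sub>M count_space UNIV"
    using measurable_compose[OF n, of "\<lambda>k. k" "count_space UNIV"] by simp
  then show "\<tau> n \<in> M \<rightarrow>\<^sub>M count_space UNIV"
    by (rule measurable_from_subalg[OF subalgebra_F, rotated]) simp
  show "\<tau> n \<omega> \<le> n" if "\<omega> \<in> space M"
    using measurable_space[OF n, of \<omega>] that by (simp add: space_F)
qed

section \<open>Pathwise consequences of honesty\<close>

lemma honest_iff:
  "honest M \<Delta> \<tau> \<longleftrightarrow>
     (\<forall>m a b c. a + b \<le> c \<longrightarrow>
       (AE \<omega> in M. a \<le> \<tau> c (\<Delta> m \<omega>) \<longrightarrow> \<tau> c (\<Delta> m \<omega>) \<le> a + b \<longrightarrow>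
          \<tau> c (\<Delta> m \<omega>) = a + \<tau> b (\<Delta> (m + int a) \<omega>)))"
  (is "_ \<longleftrightarrow> ?rhs")
proof
  assume h: "honest M \<Delta> \<tau>"
  show ?rhs
  proof (intro allI impI)
    fix m :: int and a b c :: nat
    assume "a + b \<le> c"
    then have "AE \<omega> in M. shifted_time \<Delta> \<tau> m (m + int c) \<omega> \<in> {m + int a..m + int a + int b} \<longrightarrow>
        shifted_time \<Delta> \<tau> m (m + int c) \<omega> = shifted_time \<Delta> \<tau> (m + int a) (m + int a + int b) \<omega>"
      using h unfolding honest_def by auto
    then show "AE \<omega> in M. a \<le> \<tau> c (\<Delta> m \<omega>) \<longrightarrow> \<tau> c (\<Delta> m \<omega>) \<le> a + b \<longrightarrow>
          \<tau> c (\<Delta> m \<omega>) = a + \<tau> b (\<Delta> (m + int a) \<omega>)"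
      by eventually_elim (unfold shifted_time_def, auto)
  qed
next
  assume h: ?rhs
  show "honest M \<Delta> \<tau>"
    unfolding honest_def
  proof (intro allI impI)
    fix m k l n :: int
    assume *: "m \<le> k \<and> k \<le> l \<and> l \<le> n"
    \<comment> \<open>Natural offsets replace the integer endpoints: \<open>k\<close> and
      \<open>n\<close> are measured from \<open>m\<close>, and \<open>l\<close> from
      \<open>k\<close>. This turns \<open>shifted_time\<close> into plain values of
      \<open>\<tau>\<close>.\<close>
    define a b c where "a = nat (k - m)" and "b = nat (l - k)" and "c = nat (n - m)"
    have eqs: "k = m + int a" "l = m + int a + int b" "n = m + int c" "a + b \<le> c"
      using * by (auto simp: a_def b_def c_def)
    have "AE \<omega> in M. a \<le> \<tau> c (\<Delta> m \<omega>) \<longrightarrow> \<tau> c (\<Delta> m \<omega>) \<le> a + b \<longrightarrow>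
          \<tau> c (\<Delta> m \<omega>) = a + \<tau> b (\<Delta> (m + int a) \<omega>)"
      using h eqs(4) by blast
    then show "AE \<omega> in M. shifted_time \<Delta> \<tau> m n \<omega> \<in> {k..l} \<longrightarrow>
        shifted_time \<Delta> \<tau> m n \<omega> = shifted_time \<Delta> \<tau> k l \<omega>"
      by eventually_elim (simp add: shifted_time_def eqs(1-3), linarith)
  qed
qed

text \<open>All honesty relations are assumed at one \<open>\<omega>\<close>, so the argument is
  deterministic. Honesty for \<open>[0, \<tau> n]\<close> inside \<open>[0, n]\<close> gives the
  first claim. For \<open>[0, i]\<close> inside \<open>[0, n]\<close>, a value
  \<open>\<tau> n < i\<close> would equal \<open>\<tau> i = i\<close>, which gives the second. It
  yields \<open>i \<le> \<tau> (i + n)\<close>, so \<open>[i, i + n]\<close> inside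
  \<open>[0, i + n]\<close> gives the third.\<close>

lemma honest_full_shift:
  assumes honest: "\<forall>m a b c. a + b \<le> c \<longrightarrow> a \<le> \<tau> c (\<Delta> m \<omega>) \<longrightarrow> \<tau> c (\<Delta> m \<omega>) \<le> a + b \<longrightarrow>
      \<tau> c (\<Delta> m \<omega>) = a + \<tau> b (\<Delta> (m + int a) \<omega>)"
    and le: "\<And>m n. \<tau> n (\<Delta> m \<omega>) \<le> n"
  shows "\<tau> (\<tau> n (\<Delta> m \<omega>)) (\<Delta> m \<omega>) = \<tau> n (\<Delta> m \<omega>)"
    and "i \<le> n \<Longrightarrow> \<tau> i (\<Delta> m \<omega>) = i \<Longrightarrow> i \<le> \<tau> n (\<Delta> m \<omega>)"
    and "\<tau> i (\<Delta> m \<omega>) = i \<Longrightarrow> \<tau> (i + n) (\<Delta> m \<omega>) = i + n \<longleftrightarrow> \<tau> n (\<Delta> (m + int i) \<omega>) = n"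
proof -
  show "\<tau> (\<tau> n (\<Delta> m \<omega>)) (\<Delta> m \<omega>) = \<tau> n (\<Delta> m \<omega>)"
    using honest[rule_format, of 0 "\<tau> n (\<Delta> m \<omega>)" n m] le[of n m] by simp
  show ge: "i \<le> \<tau> n (\<Delta> m \<omega>)" if "i \<le> n" "\<tau> i (\<Delta> m \<omega>) = i" for i n
    using honest[rule_format, of 0 i n m] that by force
  show "\<tau> (i + n) (\<Delta> m \<omega>) = i + n \<longleftrightarrow> \<tau> n (\<Delta> (m + int i) \<omega>) = n" if "\<tau> i (\<Delta> m \<omega>) = i"
    using honest[rule_format, of i n "i + n" m] ge[of i "i + n"] le[of "i + n" m] that by auto
qed

text \<open>Both sides regenerate at the first positive full time \<open>g\<close>: the renewal set
  by construction, the full times by honesty. The induction removes this first block, with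
  \<open>m\<close> general because the remainder starts at \<open>m + g\<close>.\<close>

lemma honest_renewal_set:
  assumes honest: "\<forall>m a b c. a + b \<le> c \<longrightarrow> a \<le> \<tau> c (\<Delta> m \<omega>) \<longrightarrow> \<tau> c (\<Delta> m \<omega>) \<le> a + b \<longrightarrow>
      \<tau> c (\<Delta> m \<omega>) = a + \<tau> b (\<Delta> (m + int a) \<omega>)"
    and le: "\<And>m n. \<tau> n (\<Delta> m \<omega>) \<le> n"
    and \<omega>: "\<omega> \<in> space M"
  shows "n \<in> renewal_set \<Delta> (first_full \<tau>) (\<Delta> m \<omega>) \<longleftrightarrow> \<tau> n (\<Delta> m \<omega>) = n"
proof (induction n arbitrary: m rule: less_induct)
  case (less n)
  let ?x = "\<Delta> m \<omega>"
  have x: "?x \<in> space M" using \<omega> by (rule shift_in_space)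
  show ?case
  proof (cases "n = 0")
    case True
    then show ?thesis using le[of 0 m] by (simp add: zero_in_renewal_set)
  next
    case False
    show ?thesis
    proof (cases "first_full \<tau> ?x \<le> enat n")
      case True
      then obtain g where g: "first_full \<tau> ?x = enat g" "g \<le> n"
        by (cases "first_full \<tau> ?x") auto
      then have "1 \<le> g"
        using first_full_ge_1[of \<tau> ?x] by (simp add: one_enat_def)
      have full: "\<tau> g ?x = g" using g(1) by (rule first_full_full)
      have "n \<in> renewal_set \<Delta> (first_full \<tau>) ?x \<longleftrightarrow> n - g \<in> renewal_set \<Delta> (first_full \<tau>) (\<Delta> (int g) ?x)"
        using renewal_set_shift[OF x time_in_renewal_set[where \<gamma> = "first_full \<tau>", OF x g(1)], of "n - g"] g
        by simp
      also have "\<Delta> (int g) ?x = \<Delta> (m + int g) \<omega>"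
        using shift_add[OF \<omega>, of "int g" m] by (simp add: add.commute)
      also have "n - g \<in> renewal_set \<Delta> (first_full \<tau>) (\<Delta> (m + int g) \<omega>) \<longleftrightarrow>
          \<tau> (n - g) (\<Delta> (m + int g) \<omega>) = n - g"
        using False \<open>1 \<le> g\<close> by (intro less.IH) auto
      also have "\<dots> \<longleftrightarrow> \<tau> n ?x = n"
        using honest_full_shift(3)[OF honest le full, of "n - g"] g by simp
      finally show ?thesis .
    next
      \<comment> \<open>Before the first full time there is neither a positive renewal nor a
        positive full time.\<close>
      case f: False
      then have "n \<notin> renewal_set \<Delta> (first_full \<tau>) ?x"
        using renewal_set_ge[OF x, of n "first_full \<tau>"] False by auto
      moreover have "\<tau> n ?x \<noteq> n"
        using f False by (auto simp: first_full_le_iff)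
      ultimately show ?thesis by simp
    qed
  qed
qed

end

subsection \<open>Splitting at a geometric time\<close>

text \<open>This is the pair \<open>X\<close> in \<open>symmetric_splitting\<close>, and
  \<open>forward_part\<close> below is \<open>Y\<close>: the path read backwards or forwards from
  the splitting time, with the length of that side.\<close>

definition reversed_part ::
  "(int \<Rightarrow> 'a \<Rightarrow> 'a) \<Rightarrow> ('a \<Rightarrow> 'a) \<Rightarrow> (nat \<Rightarrow> 'a \<Rightarrow> nat) \<Rightarrow> 'a \<times> nat \<Rightarrow> 'a \<times> nat" where
  "reversed_part \<Delta> r \<tau> = (\<lambda>(\<omega>, g). (r (\<Delta> (int (\<tau> g \<omega>)) \<omega>), \<tau> g \<omega>))"

definition forward_part ::
  "(int \<Rightarrow> 'a \<Rightarrow> 'a) \<Rightarrow> (nat \<Rightarrow> 'a \<Rightarrow> nat) \<Rightarrow> 'a \<times> nat \<Rightarrow> 'a \<times> nat" where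
  "forward_part \<Delta> \<tau> = (\<lambda>(\<omega>, g). (\<Delta> (int (\<tau> g \<omega>)) \<omega>, g - \<tau> g \<omega>))"

context time_symmetric_noise
begin

section \<open>Time reversal and independence of past and future\<close>

lemma reversal_in_space: "\<omega> \<in> space M \<Longrightarrow> r \<omega> \<in> space M"
  by (rule measurable_space[OF reversal_measurable])

lemma AE_reversal: "AE \<omega> in M. P \<omega> \<Longrightarrow> AE \<omega> in M. P (r \<omega>)"
  using AE_distrD[OF reversal_measurable, of P] unfolding reversal_preserving .

lemma prob_reversal: "A \<in> sets M \<Longrightarrow> prob (r -` A \<inter> space M) = prob A"
  using measure_distr[OF reversal_measurable, of A] unfolding reversal_preserving by simp

text \<open>Any two generators lie in \<open>F (- int k) 0\<close> and \<open>F 0 (int k)\<close>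
  for a common \<open>k\<close>, and these adjacent fields are independent. Both generating families
  are intersection-stable, so independence extends to the sigma-fields.\<close>

lemma indep_past_future:
  "indep_set (sigma_sets (space M) (\<Union>n::nat. sets (F (- int n) 0)))
     (sigma_sets (space M) (\<Union>n::nat. sets (F 0 (int n))))"
proof (rule indep_set_sigma_sets)
  show "indep_set (\<Union>n::nat. sets (F (- int n) 0)) (\<Union>n::nat. sets (F 0 (int n)))"
    unfolding indep_sets2_eq
  proof (intro conjI ballI)
    show "(\<Union>n::nat. sets (F (- int n) 0)) \<subseteq> events" "(\<Union>n::nat. sets (F 0 (int n))) \<subseteq> events"
      by (intro UN_least sets_F_subset; simp)+
  next
    fix A B assume "A \<in> (\<Union>n::nat. sets (F (- int n) 0))" "B \<in> (\<Union>n::nat. sets (F 0 (int n)))"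
    then obtain i j :: nat where "A \<in> sets (F (- int i) 0)" "B \<in> sets (F 0 (int j))" by blast
    moreover define k where "k = max i j"
    moreover have "sets (F (- int i) 0) \<subseteq> sets (F (- int k) 0)" "sets (F 0 (int j)) \<subseteq> sets (F 0 (int k))"
      by (rule sets_F_mono; simp add: k_def)+
    ultimately have "A \<in> sets (F (- int k) 0)" "B \<in> sets (F 0 (int k))" by auto
    then show "prob (A \<inter> B) = prob A * prob B"
      using indep_setD[OF indep_F[of "- int k" 0 "int k"]] by simp
  qed
  show "Int_stable (\<Union>n::nat. sets (F (- int n) 0))" "Int_stable (\<Union>n::nat. sets (F 0 (int n)))"
    by (intro Int_stable_UN_F; simp)+
qed

text \<open>Reversal carries fields to the right of 0 into fields to the left of 0, and preimages
  commute with complements and countable unions; hence the induction on the generation of the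
  sigma-field.\<close>

lemma reversal_vimage_F_infty:
  assumes "A \<in> sets (F_infty M F)"
  shows "r -` A \<inter> space M \<in> sigma_sets (space M) (\<Union>n::nat. sets (F (- int n) 0))"
  using assms unfolding sets_F_infty
proof induction
  case (Basic A)
  then obtain n where "A \<in> sets (F 0 (int n))" by blast
  then have "r -` A \<inter> space M \<in> sets (F (- int n) 0)"
    using reversal_F[of 0 "int n"] by auto
  then show ?case by (intro sigma_sets.Basic) blast
next
  case Empty
  show ?case by (simp add: sigma_sets.Empty)
next
  case (Compl A)
  have "r -` (space M - A) \<inter> space M = space M - (r -` A \<inter> space M)"
    using reversal_in_space by auto
  then show ?case using sigma_sets.Compl[OF Compl.IH] by simp
next
  case (Union A)
  have "r -` (\<Union>i. A i) \<inter> space M = (\<Union>i. r -` A i \<inter> space M)" by auto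
  then show ?case using sigma_sets.Union[OF Union.IH] by simp
qed

text \<open>Shift invariance moves the time \<open>h\<close> to 0, where past and future are
  independent, and reversal preserves the probability of \<open>A\<close>.\<close>

lemma prob_reversed_past_Int_future:
  assumes "A \<in> sets (F_infty M F)" "B \<in> sets (F_infty M F)"
  shows "prob {\<omega> \<in> space M. r (\<Delta> h \<omega>) \<in> A \<and> \<Delta> h \<omega> \<in> B} = prob A * prob B"
proof -
  have sets: "A \<in> sets M" "B \<in> sets M" "r -` A \<inter> space M \<in> sets M"
    using assms sets_F_infty_subset reversal_measurable by (auto intro: measurable_sets)
  have "{\<omega> \<in> space M. r (\<Delta> h \<omega>) \<in> A \<and> \<Delta> h \<omega> \<in> B} = \<Delta> h -` ((r -` A \<inter> space M) \<inter> B) \<inter> space M"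
    using shift_in_space by auto
  then have "prob {\<omega> \<in> space M. r (\<Delta> h \<omega>) \<in> A \<and> \<Delta> h \<omega> \<in> B} = prob ((r -` A \<inter> space M) \<inter> B)"
    using prob_shift[of "(r -` A \<inter> space M) \<inter> B" h] sets.Int[OF sets(3,2)] by presburger
  also have "\<dots> = prob (r -` A \<inter> space M) * prob B"
    using indep_setD[OF indep_past_future] reversal_vimage_F_infty assms unfolding sets_F_infty by blast
  finally show ?thesis using prob_reversal sets by simp
qed

text \<open>Reversal conjugates each shift to its inverse, so \<open>r\<close> after
  \<open>\<Delta> (int n)\<close> is an involution, and its preimages send
  \<open>F 0 (int n)\<close> to itself. Any event known at time \<open>n\<close> can thus be read on
  the path reversed from \<open>n\<close>; the witness is the preimage of \<open>A\<close>.\<close>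

lemma reversal_shift_vimage:
  assumes "A \<in> sets (F 0 (int n))"
  obtains C where "C \<in> sets (F 0 (int n))" "\<And>\<omega>. \<omega> \<in> space M \<Longrightarrow> r (\<Delta> (int n) \<omega>) \<in> C \<longleftrightarrow> \<omega> \<in> A"
proof
  let ?C = "(\<lambda>\<omega>. r (\<Delta> (int n) \<omega>)) -` A \<inter> space M"
  have "r -` A \<inter> space M \<in> sets (F (- int n) 0)"
    using reversal_F[of 0 "int n"] assms by auto
  then have "\<Delta> (int n) -` (r -` A \<inter> space M) \<inter> space M \<in> sets (F 0 (int n))"
    using shift_vimage[of "- int n" 0 "r -` A \<inter> space M" "int n"] by (simp del: vimage_Int)
  also have "\<Delta> (int n) -` (r -` A \<inter> space M) \<inter> space M = ?C"
    using shift_in_space by auto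
  finally show "?C \<in> sets (F 0 (int n))" .
  fix \<omega> assume \<omega>: "\<omega> \<in> space M"
  then have "r (\<Delta> (int n) (r (\<Delta> (int n) \<omega>))) = \<omega>"
    using reversal_shift[of "r (\<Delta> (int n) \<omega>)" "int n"] reversal_involution shift_in_space reversal_in_space
      shift_add[OF \<omega>, of "- int n" "int n"] shift_zero by simp
  then show "r (\<Delta> (int n) \<omega>) \<in> ?C \<longleftrightarrow> \<omega> \<in> A"
    using \<omega> shift_in_space reversal_in_space by simp
qed

section \<open>The joint law of the two parts\<close>

lemma measurable_parts:
  fixes p :: real
  assumes \<tau>: "random_index_family F \<tau>"
  defines "N \<equiv> M \<Otimes>\<^sub>M measure_pmf (geometric_pmf p)"
    and "S \<equiv> F_infty M F \<Otimes>\<^sub>M count_space (UNIV :: nat set)"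
  shows "reversed_part \<Delta> r \<tau> \<in> N \<rightarrow>\<^sub>M S" "forward_part \<Delta> \<tau> \<in> N \<rightarrow>\<^sub>M S"
proof -
  note [measurable] = random_index_family_measurable(1)[OF \<tau>] shift_measurable reversal_measurable
  have snd: "snd \<in> N \<rightarrow>\<^sub>M count_space UNIV"
    unfolding N_def by measurable
  have fst: "fst \<in> N \<rightarrow>\<^sub>M M"
    unfolding N_def by measurable
  \<comment> \<open>The index is random but countably valued, so measurability for each fixed value
    suffices, here and for the shift below.\<close>
  have t: "(\<lambda>x. \<tau> (snd x) (fst x)) \<in> N \<rightarrow>\<^sub>M count_space UNIV"
    by (rule measurable_compose_countable[OF measurable_compose[OF fst] snd]) measurable
  have d: "(\<lambda>x. \<Delta> (int (\<tau> (snd x) (fst x))) (fst x)) \<in> N \<rightarrow>\<^sub>M M"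
    by (rule measurable_compose_countable[OF measurable_compose[OF fst] t]) measurable
  have m: "(\<lambda>x. snd x - \<tau> (snd x) (fst x)) \<in> N \<rightarrow>\<^sub>M count_space UNIV"
    using snd t by measurable
  show "reversed_part \<Delta> r \<tau> \<in> N \<rightarrow>\<^sub>M S"
    unfolding reversed_part_def S_def case_prod_beta
    by (intro measurable_Pair t measurable_F_infty measurable_compose[OF d reversal_measurable])
  show "forward_part \<Delta> \<tau> \<in> N \<rightarrow>\<^sub>M S"
    unfolding forward_part_def S_def case_prod_beta
    by (intro measurable_Pair m measurable_F_infty d)
qed

text \<open>The two lengths add up to \<open>g\<close>, so the event forces \<open>g = i + j\<close>
  and becomes the product \<open>E \<times> {i + j}\<close>. The geometric mass splits off, and
  \<open>split\<close> lets the independence of past and future factor the probability of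
  \<open>E\<close>.\<close>

lemma emeasure_parts_rectangle:
  fixes p :: real
  assumes p: "0 < p" "p < 1" and \<tau>: "random_index_family F \<tau>"
    and sets: "A \<in> sets (F_infty M F)" "B \<in> sets (F_infty M F)"
      "G \<in> sets (F_infty M F)" "H \<in> sets (F_infty M F)"
    and split: "AE \<omega> in M. \<tau> (i + j) \<omega> = i \<longleftrightarrow> r (\<Delta> (int i) \<omega>) \<in> G \<and> \<Delta> (int i) \<omega> \<in> H"
  defines "N \<equiv> M \<Otimes>\<^sub>M measure_pmf (geometric_pmf p)"
  shows "emeasure N {x \<in> space N. reversed_part \<Delta> r \<tau> x \<in> A \<times> {i} \<and> forward_part \<Delta> \<tau> x \<in> B \<times> {j}} =
    ennreal (p * (1 - p) ^ (i + j) * (prob (A \<inter> G) * prob (B \<inter> H)))"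
proof -
  note [measurable] = random_index_family_measurable(1)[OF \<tau>] shift_measurable reversal_measurable
  have [measurable]: "A \<in> sets M" "B \<in> sets M" "G \<in> sets M" "H \<in> sets M"
    using sets sets_F_infty_subset by auto
  define E where "E = {\<omega> \<in> space M. \<tau> (i + j) \<omega> = i \<and> r (\<Delta> (int i) \<omega>) \<in> A \<and> \<Delta> (int i) \<omega> \<in> B}"
  have [measurable]: "E \<in> sets M" unfolding E_def by measurable
  have "{x \<in> space N. reversed_part \<Delta> r \<tau> x \<in> A \<times> {i} \<and> forward_part \<Delta> \<tau> x \<in> B \<times> {j}} = E \<times> {i + j}"
  proof (intro set_eqI iffI)
    fix x assume "x \<in> {x \<in> space N. reversed_part \<Delta> r \<tau> x \<in> A \<times> {i} \<and> forward_part \<Delta> \<tau> x \<in> B \<times> {j}}"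
    \<comment> \<open>The bound \<open>\<tau> g \<le> g\<close> makes the truncated subtraction
      exact, so the lengths \<open>i\<close> and \<open>j\<close> determine
      \<open>g\<close>.\<close>
    then show "x \<in> E \<times> {i + j}"
      using random_index_family_measurable(2)[OF \<tau>, of "fst x" "snd x"]
      by (auto simp: N_def E_def space_pair_measure reversed_part_def forward_part_def)
  next
    fix x assume "x \<in> E \<times> {i + j}"
    then show "x \<in> {x \<in> space N. reversed_part \<Delta> r \<tau> x \<in> A \<times> {i} \<and> forward_part \<Delta> \<tau> x \<in> B \<times> {j}}"
      by (auto simp: N_def E_def space_pair_measure reversed_part_def forward_part_def)
  qed
  moreover have "emeasure N (E \<times> {i + j}) = emeasure M E * ennreal ((1 - p) ^ (i + j) * p)"
    using p unfolding N_def
    by (subst measure_pmf.emeasure_pair_measure_Times) (auto simp: emeasure_pmf_single)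
  moreover have "prob E = prob {\<omega> \<in> space M. r (\<Delta> (int i) \<omega>) \<in> A \<inter> G \<and> \<Delta> (int i) \<omega> \<in> B \<inter> H}"
    unfolding E_def
  proof (rule finite_measure_eq_AE)
    show "AE \<omega> in M. \<omega> \<in> {\<omega> \<in> space M. \<tau> (i + j) \<omega> = i \<and> r (\<Delta> (int i) \<omega>) \<in> A \<and> \<Delta> (int i) \<omega> \<in> B} \<longleftrightarrow>
        \<omega> \<in> {\<omega> \<in> space M. r (\<Delta> (int i) \<omega>) \<in> A \<inter> G \<and> \<Delta> (int i) \<omega> \<in> B \<inter> H}"
      using split by eventually_elim auto
  qed measurable
  then have "prob E = prob (A \<inter> G) * prob (B \<inter> H)"
    using prob_reversed_past_Int_future[of "A \<inter> G" "B \<inter> H" "int i"] sets by simp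
  ultimately show ?thesis
    using p by (simp add: emeasure_eq_measure ennreal_mult[symmetric] mult_ac)
qed

text \<open>The same events \<open>G\<close> describe both sides, so the joint law is the product of
  one measure with itself. Normalisation makes that measure a probability, hence the law of each
  part; this gives independence and equality of laws at once.\<close>

lemma symmetric_splittingI:
  assumes \<tau>: "random_index_family F \<tau>"
    and G: "\<And>i. G i \<in> sets (F_infty M F)"
    and split: "\<And>i j. AE \<omega> in M. \<tau> (i + j) \<omega> = i \<longleftrightarrow> r (\<Delta> (int i) \<omega>) \<in> G i \<and> \<Delta> (int i) \<omega> \<in> G j"
  shows "symmetric_splitting M F \<Delta> r \<tau>"
  unfolding symmetric_splitting_def Let_def reversed_part_def[symmetric] forward_part_def[symmetric]
proof (intro conjI allI impI \<tau>)
  fix p :: real assume "0 < p \<and> p < 1"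
  then have p: "0 < p" "p < 1" by auto
  define N where "N = M \<Otimes>\<^sub>M measure_pmf (geometric_pmf p)"
  define S where "S = F_infty M F \<Otimes>\<^sub>M count_space (UNIV :: nat set)"
  interpret N: prob_space N
    unfolding N_def by (intro prob_space_pair prob_space_axioms measure_pmf.prob_space_axioms)
  let ?X = "reversed_part \<Delta> r \<tau>" and ?Y = "forward_part \<Delta> \<tau>"
  note X = measurable_parts(1)[OF \<tau>, of p, folded N_def S_def]
    and Y = measurable_parts(2)[OF \<tau>, of p, folded N_def S_def]
  \<comment> \<open>The factor \<open>sqrt p\<close> shares \<open>p\<close> evenly between the two
    sides, so that \<open>p * (1 - p) ^ (i + j)\<close> is a product of two factors of the same
    form.\<close>
  define f where "f A i = ennreal (sqrt p * (1 - p) ^ i * prob ((\<lambda>\<omega>. (\<omega>, i)) -` A \<inter> G i))" for A i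
  define \<nu> where "\<nu> A = (\<integral>\<^sup>+i. f A i \<partial>count_space UNIV)" for A
  have joint: "emeasure N {x \<in> space N. ?X x \<in> A \<and> ?Y x \<in> B} = \<nu> A * \<nu> B"
    if AB: "A \<in> sets S" "B \<in> sets S" for A B
  proof -
    \<comment> \<open>Partition by the two lengths \<open>i\<close> and \<open>j\<close>; taking
      sections of \<open>A\<close> and \<open>B\<close> at these values reduces each piece to a
      rectangle.\<close>
    define E where "E = (\<lambda>(i, j). {x \<in> space N. ?X x \<in> ((\<lambda>\<omega>. (\<omega>, i)) -` A) \<times> {i} \<and>
        ?Y x \<in> ((\<lambda>\<omega>. (\<omega>, j)) -` B) \<times> {j}})"
    have sec: "(\<lambda>\<omega>. (\<omega>, i)) -` A \<in> sets (F_infty M F)" "(\<lambda>\<omega>. (\<omega>, j)) -` B \<in> sets (F_infty M F)" for i j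
      using AB unfolding S_def by (auto intro: sets_Pair2)
    have E: "emeasure N (E (i, j)) = f A i * f B j" for i j
    proof -
      have "emeasure N (E (i, j)) = ennreal (p * (1 - p) ^ (i + j) *
          (prob ((\<lambda>\<omega>. (\<omega>, i)) -` A \<inter> G i) * prob ((\<lambda>\<omega>. (\<omega>, j)) -` B \<inter> G j)))"
        unfolding E_def prod.case N_def
        by (rule emeasure_parts_rectangle[OF p \<tau> sec G G split])
      also have "\<dots> = f A i * f B j"
        using p by (simp add: f_def ennreal_mult'[symmetric] power_add mult_ac)
      finally show ?thesis .
    qed
    have meas: "E ij \<in> sets N" for ij
    proof (cases ij)
      case (Pair i j)
      have "((\<lambda>\<omega>. (\<omega>, i)) -` A) \<times> {i} \<in> sets S" "((\<lambda>\<omega>. (\<omega>, j)) -` B) \<times> {j} \<in> sets S"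
        unfolding S_def using sec by auto
      from measurable_sets[OF X this(1)] measurable_sets[OF Y this(2)]
      have "?X -` (((\<lambda>\<omega>. (\<omega>, i)) -` A) \<times> {i}) \<inter> space N \<inter>
          (?Y -` (((\<lambda>\<omega>. (\<omega>, j)) -` B) \<times> {j}) \<inter> space N) \<in> sets N"
        by (rule sets.Int)
      also have "?X -` (((\<lambda>\<omega>. (\<omega>, i)) -` A) \<times> {i}) \<inter> space N \<inter>
          (?Y -` (((\<lambda>\<omega>. (\<omega>, j)) -` B) \<times> {j}) \<inter> space N) = E ij"
        unfolding E_def Pair by auto
      finally show ?thesis .
    qed
    have "{x \<in> space N. ?X x \<in> A \<and> ?Y x \<in> B} = (\<Union>ij\<in>UNIV. E ij)"
      unfolding E_def by (auto simp: mem_Times_iff)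
    also have "emeasure N \<dots> = (\<integral>\<^sup>+ij. emeasure N (E ij) \<partial>count_space UNIV)"
      using meas by (intro emeasure_UN_countable) (auto simp: disjoint_family_on_def E_def)
    also have "\<dots> = (\<integral>\<^sup>+i. \<integral>\<^sup>+j. emeasure N (E (i, j)) \<partial>count_space UNIV \<partial>count_space UNIV)"
      by (rule nn_integral_fst_count_space[symmetric])
    also have "\<dots> = \<nu> A * \<nu> B"
      by (simp add: E \<nu>_def nn_integral_cmult nn_integral_multc)
    finally show ?thesis .
  qed
  have XS: "?X x \<in> space S" and YS: "?Y x \<in> space S" if "x \<in> space N" for x
    using measurable_space[OF X that] measurable_space[OF Y that] .
  have "emeasure N {x \<in> space N. ?X x \<in> space S \<and> ?Y x \<in> space S} = \<nu> (space S) * \<nu> (space S)"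
    by (rule joint) auto
  moreover have "{x \<in> space N. ?X x \<in> space S \<and> ?Y x \<in> space S} = space N"
    using XS YS by auto
  ultimately have "\<nu> (space S) * \<nu> (space S) = 1"
    by (simp add: N.emeasure_space_1)
  \<comment> \<open>The only nonnegative square root of 1 is 1, and an infinite value would have an
    infinite square.\<close>
  then have \<nu>_space: "\<nu> (space S) = 1"
    by (cases "\<nu> (space S)") (auto simp: ennreal_mult[symmetric] square_eq_1_iff ennreal_top_mult)
  \<comment> \<open>Leaving the other part unconstrained contributes the factor
    \<open>\<nu> (space S) = 1\<close>, so \<open>\<nu>\<close> is the law of each part.\<close>
  have dX: "emeasure (distr N S ?X) A = \<nu> A" if "A \<in> sets S" for A
  proof -
    have "?X -` A \<inter> space N = {x \<in> space N. ?X x \<in> A \<and> ?Y x \<in> space S}" using YS by auto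
    then show ?thesis using joint[OF that sets.top] \<nu>_space by (simp add: emeasure_distr[OF X that])
  qed
  have dY: "emeasure (distr N S ?Y) A = \<nu> A" if "A \<in> sets S" for A
  proof -
    have "?Y -` A \<inter> space N = {x \<in> space N. ?X x \<in> space S \<and> ?Y x \<in> A}" using XS by auto
    then show ?thesis using joint[OF sets.top that] \<nu>_space by (simp add: emeasure_distr[OF Y that])
  qed
  have XY: "(\<lambda>x. (?X x, ?Y x)) \<in> N \<rightarrow>\<^sub>M S \<Otimes>\<^sub>M S"
    using X Y by (rule measurable_Pair)
  show "prob_space.indep_var (M \<Otimes>\<^sub>M measure_pmf (geometric_pmf p))
      (F_infty M F \<Otimes>\<^sub>M count_space UNIV) ?X (F_infty M F \<Otimes>\<^sub>M count_space UNIV) ?Y"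
    unfolding N_def[symmetric] S_def[symmetric] N.indep_var_distribution_eq
  proof (intro conjI X Y pair_measure_eqI)
    show "sigma_finite_measure (distr N S ?X)" "sigma_finite_measure (distr N S ?Y)"
      using N.prob_space_distr[OF X] N.prob_space_distr[OF Y] by (auto intro: prob_space_imp_sigma_finite)
    show "sets (distr N S ?X \<Otimes>\<^sub>M distr N S ?Y) = sets (distr N (S \<Otimes>\<^sub>M S) (\<lambda>x. (?X x, ?Y x)))"
      by (simp cong: sets_pair_measure_cong)
    fix A B assume "A \<in> sets (distr N S ?X)" "B \<in> sets (distr N S ?Y)"
    then have AB: "A \<in> sets S" "B \<in> sets S" by auto
    have "(\<lambda>x. (?X x, ?Y x)) -` (A \<times> B) \<inter> space N = {x \<in> space N. ?X x \<in> A \<and> ?Y x \<in> B}" by auto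
    then have "emeasure (distr N (S \<Otimes>\<^sub>M S) (\<lambda>x. (?X x, ?Y x))) (A \<times> B) = \<nu> A * \<nu> B"
      using AB by (simp add: emeasure_distr[OF XY] joint)
    then show "emeasure (distr N S ?X) A * emeasure (distr N S ?Y) B =
        emeasure (distr N (S \<Otimes>\<^sub>M S) (\<lambda>x. (?X x, ?Y x))) (A \<times> B)"
      using AB dX dY by simp
  qed
  show "distr (M \<Otimes>\<^sub>M measure_pmf (geometric_pmf p)) (F_infty M F \<Otimes>\<^sub>M count_space UNIV) ?X =
      distr (M \<Otimes>\<^sub>M measure_pmf (geometric_pmf p)) (F_infty M F \<Otimes>\<^sub>M count_space UNIV) ?Y"
    unfolding N_def[symmetric] S_def[symmetric]
    by (rule measure_eqI) (auto simp: dX dY)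
qed

subsection \<open>Honest splittings and self-dual times\<close>

text \<open>The right side sees the starting point \<open>m\<close> only through the end point
  \<open>m + n\<close>, which allows renewal sets started from different integers to be compared.
  The countably many null sets are joined into one.\<close>

lemma AE_self_dual_shift:
  assumes "self_dual M \<Delta> r \<gamma>"
  shows "AE \<omega> in M. \<forall>m n. n \<in> renewal_set \<Delta> \<gamma> (\<Delta> m \<omega>) \<longleftrightarrow> enat n < \<gamma> (r (\<Delta> (m + int n) \<omega>))"
  unfolding AE_all_countable
proof (intro allI)
  fix m n
  have "AE \<omega> in M. n \<in> renewal_set \<Delta> \<gamma> (\<Delta> m \<omega>) \<longleftrightarrow> enat n < \<gamma> (r (\<Delta> (int n) (\<Delta> m \<omega>)))"
    using assms unfolding self_dual_def by (intro AE_shift) blast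
  then show "AE \<omega> in M. n \<in> renewal_set \<Delta> \<gamma> (\<Delta> m \<omega>) \<longleftrightarrow> enat n < \<gamma> (r (\<Delta> (m + int n) \<omega>))"
    using AE_space by eventually_elim (simp add: shift_add add.commute[of m])
qed

text \<open>A renewal at or after \<open>m + a\<close> seen from \<open>m\<close> remains one when
  the start moves to \<open>m + a\<close>, because self-duality then asks the reversed
  \<open>\<gamma>\<close> to exceed a shorter length. From that common renewal on, regeneration
  makes the two renewal sets agree.\<close>

lemma honest_last_renewal:
  assumes "self_dual M \<Delta> r \<gamma>"
  shows "honest M \<Delta> (last_renewal \<Delta> \<gamma>)"
  unfolding honest_iff
proof (intro allI impI)
  fix m :: int and a b c :: nat
  assume "a + b \<le> c"
  show "AE \<omega> in M. a \<le> last_renewal \<Delta> \<gamma> c (\<Delta> m \<omega>) \<longrightarrow> last_renewal \<Delta> \<gamma> c (\<Delta> m \<omega>) \<le> a + b \<longrightarrow>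
      last_renewal \<Delta> \<gamma> c (\<Delta> m \<omega>) = a + last_renewal \<Delta> \<gamma> b (\<Delta> (m + int a) \<omega>)"
    using AE_self_dual_shift[OF assms] AE_space
  proof eventually_elim
    case (elim \<omega>)
    show ?case
    proof (intro impI)
      let ?x = "\<Delta> m \<omega>" and ?y = "\<Delta> (m + int a) \<omega>"
      define t where "t = last_renewal \<Delta> \<gamma> c ?x"
      assume "a \<le> last_renewal \<Delta> \<gamma> c ?x" "last_renewal \<Delta> \<gamma> c ?x \<le> a + b"
      then obtain d where d: "t = a + d" "d \<le> b"
        unfolding t_def by (metis add_le_cancel_left le_iff_add)
      have t: "t \<in> renewal_set \<Delta> \<gamma> ?x" "t \<le> c" "\<And>k. k \<in> renewal_set \<Delta> \<gamma> ?x \<Longrightarrow> k \<le> c \<Longrightarrow> k \<le> t"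
        using last_renewal_eq_iff[of \<Delta> \<gamma> c ?x t] unfolding t_def by auto
      have "enat (a + d) < \<gamma> (r (\<Delta> (m + int (a + d)) \<omega>))"
        using t(1) elim d by blast
      then have "enat d < \<gamma> (r (\<Delta> ((m + int a) + int d) \<omega>))"
        by (simp add: add.assoc) (meson enat_ord_simps(1) le_add2 le_less_trans)
      then have dy: "d \<in> renewal_set \<Delta> \<gamma> ?y"
        using elim by blast
      have xt: "\<Delta> (int t) ?x = \<Delta> (m + int t) \<omega>" "\<Delta> (int d) ?y = \<Delta> (m + int t) \<omega>"
        using shift_add[of \<omega> "int t" m] shift_add[of \<omega> "int d" "m + int a"] elim d
        by (simp_all add: algebra_simps)
      \<comment> \<open>A renewal of \<open>?y\<close> past \<open>d\<close> would be one of
        \<open>?x\<close> past \<open>t\<close>, and \<open>a + b \<le> c\<close> keeps it in the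
        window where \<open>t\<close> is last.\<close>
      have "k \<le> d" if k: "k \<in> renewal_set \<Delta> \<gamma> ?y" "k \<le> b" for k
      proof (rule ccontr)
        assume "\<not> k \<le> d"
        then obtain q where q: "k = d + q" "0 < q" by (metis less_imp_add_positive not_le)
        then have "q \<in> renewal_set \<Delta> \<gamma> (\<Delta> (int d) ?y)"
          using renewal_set_shift[OF _ dy, of q] k shift_in_space elim by blast
        then have "t + q \<in> renewal_set \<Delta> \<gamma> ?x"
          using renewal_set_shift[OF _ t(1), of q] xt shift_in_space elim by simp
        then show False
          using t(3)[of "t + q"] q d k \<open>a + b \<le> c\<close> by simp
      qed
      then have "last_renewal \<Delta> \<gamma> b ?y = d"
        using dy d by (simp add: last_renewal_eq_iff)
      then show "last_renewal \<Delta> \<gamma> c ?x = a + last_renewal \<Delta> \<gamma> b ?y"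
        using d unfolding t_def by simp
    qed
  qed
qed

lemma last_renewal_in_honest_splittings:
  assumes "\<gamma> \<in> self_dual_times M F \<Delta> r"
  shows "last_renewal \<Delta> \<gamma> \<in> honest_splittings M F \<Delta> r"
proof -
  have \<gamma>: "positive_stopping_time M F \<gamma>" and dual: "self_dual M \<Delta> r \<gamma>"
    using assms by (auto simp: self_dual_times_def)
  have ge1: "1 \<le> \<gamma> \<omega>" if "\<omega> \<in> space M" for \<omega>
    using \<gamma> that by (simp add: positive_stopping_time_def)
  have "symmetric_splitting M F \<Delta> r (last_renewal \<Delta> \<gamma>)"
  proof (rule symmetric_splittingI[OF random_index_family_last_renewal[OF \<gamma>]])
    fix i j
    show "{\<omega> \<in> space M. enat i < \<gamma> \<omega>} \<in> sets (F_infty M F)"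
      using \<gamma> by (rule stopping_time_exceeds)
    \<comment> \<open>Self-duality replaces the past condition, that \<open>i\<close> is a renewal,
      by the event \<open>i < \<gamma>\<close> on the reversed path, so both sides use the same
      family of events.\<close>
    have "AE \<omega> in M. i \<in> renewal_set \<Delta> \<gamma> \<omega> \<longleftrightarrow> enat i < \<gamma> (r (\<Delta> (int i) \<omega>))"
      using dual by (auto simp: self_dual_def)
    then show "AE \<omega> in M. last_renewal \<Delta> \<gamma> (i + j) \<omega> = i \<longleftrightarrow>
        r (\<Delta> (int i) \<omega>) \<in> {\<omega> \<in> space M. enat i < \<gamma> \<omega>} \<and> \<Delta> (int i) \<omega> \<in> {\<omega> \<in> space M. enat j < \<gamma> \<omega>}"
      using AE_space
      by eventually_elim (simp add: last_renewal_split ge1 shift_in_space reversal_in_space)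
  qed
  then show ?thesis
    using honest_last_renewal[OF dual] by (simp add: honest_splittings_def)
qed

section \<open>From honest splittings to self-dual times\<close>

lemma honest_splitting_AE:
  assumes "\<tau> \<in> honest_splittings M F \<Delta> r"
  shows "AE \<omega> in M. \<forall>n. (n \<in> renewal_set \<Delta> (first_full \<tau>) \<omega> \<longleftrightarrow> \<tau> n \<omega> = n) \<and>
    last_renewal \<Delta> (first_full \<tau>) n \<omega> = \<tau> n \<omega>"
proof -
  have \<tau>: "random_index_family F \<tau>" and honest: "honest M \<Delta> \<tau>"
    using assms by (auto simp: honest_splittings_def symmetric_splitting_def)
  have "AE \<omega> in M. a + b \<le> c \<longrightarrow> a \<le> \<tau> c (\<Delta> m \<omega>) \<longrightarrow> \<tau> c (\<Delta> m \<omega>) \<le> a + b \<longrightarrow>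
      \<tau> c (\<Delta> m \<omega>) = a + \<tau> b (\<Delta> (m + int a) \<omega>)" for m a b c
    using honest unfolding honest_iff by (cases "a + b \<le> c") simp_all
  \<comment> \<open>The countably many honesty relations are put on one null set, off which the
    pathwise lemmas apply.\<close>
  then have "AE \<omega> in M. \<forall>m a b c. a + b \<le> c \<longrightarrow> a \<le> \<tau> c (\<Delta> m \<omega>) \<longrightarrow> \<tau> c (\<Delta> m \<omega>) \<le> a + b \<longrightarrow>
      \<tau> c (\<Delta> m \<omega>) = a + \<tau> b (\<Delta> (m + int a) \<omega>)"
    unfolding AE_all_countable by blast
  then show ?thesis
    using AE_space
  proof eventually_elim
    case (elim \<omega>)
    have le: "\<tau> n (\<Delta> m \<omega>) \<le> n" for m n
      using random_index_family_measurable(2)[OF \<tau>] shift_in_space elim(2) by blast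
    have zero: "\<Delta> 0 \<omega> = \<omega>" using elim(2) by (rule shift_zero)
    have full: "n \<in> renewal_set \<Delta> (first_full \<tau>) \<omega> \<longleftrightarrow> \<tau> n \<omega> = n" for n
      using honest_renewal_set[where m = 0, OF elim(1) le elim(2)] zero by simp
    moreover have "last_renewal \<Delta> (first_full \<tau>) n \<omega> = \<tau> n \<omega>" for n
      unfolding last_renewal_eq_iff full
    proof (intro conjI ballI impI)
      show "\<tau> (\<tau> n \<omega>) \<omega> = \<tau> n \<omega>"
        using honest_full_shift(1)[where m = 0, OF elim(1) le] by (simp only: zero)
      show "\<tau> n \<omega> \<le> n"
        using le[of n 0] by (simp only: zero)
      fix k assume "k \<in> renewal_set \<Delta> (first_full \<tau>) \<omega>" "k \<le> n"
      then show "k \<le> \<tau> n \<omega>"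
        using honest_full_shift(2)[where m = 0, OF elim(1) le, of k n] by (simp only: zero full)
    qed
    ultimately show ?case by blast
  qed
qed

text \<open>The parts are independent with a common law, so exchanging the lengths
  \<open>(0, n)\<close> and \<open>(n, 0)\<close> together with the test sets keeps the probability.
  The first rectangle sees \<open>n < \<gamma>\<close> on the future, the second sees on the
  reversed past that \<open>n\<close> is full; varying the test set \<open>A\<close> identifies the
  two events.\<close>

lemma self_dual_first_full:
  assumes "\<tau> \<in> honest_splittings M F \<Delta> r"
  shows "self_dual M \<Delta> r (first_full \<tau>)"
  unfolding self_dual_def
proof
  fix n
  let ?\<gamma> = "first_full \<tau>"
  have \<tau>: "random_index_family F \<tau>" and splitting: "symmetric_splitting M F \<Delta> r \<tau>"
    using assms by (auto simp: honest_splittings_def symmetric_splitting_def)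
  define G where "G i = {\<omega> \<in> space M. enat i < ?\<gamma> \<omega>}" for i
  have G: "G i \<in> sets (F_infty M F)" for i
    unfolding G_def by (intro stopping_time_exceeds positive_stopping_time_first_full \<tau>)
  note full = honest_splitting_AE[OF assms]
  have "\<tau> n -` {n} \<inter> space (F 0 (int n)) \<in> sets (F 0 (int n))"
    using \<tau> by (intro measurable_sets[of _ _ "count_space {0..n}"]) (auto simp: random_index_family_def)
  \<comment> \<open>\<open>C\<close> is the event that \<open>n\<close> is full, expressed on the
    path reversed from \<open>n\<close>.\<close>
  from reversal_shift_vimage[OF this] obtain C where "C \<in> sets (F 0 (int n))"
    and "\<And>\<omega>. \<omega> \<in> space M \<Longrightarrow> r (\<Delta> (int n) \<omega>) \<in> C \<longleftrightarrow> \<omega> \<in> \<tau> n -` {n} \<inter> space (F 0 (int n))"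
    by blast
  then have C: "C \<in> sets (F_infty M F)"
    and C_iff: "\<And>\<omega>. \<omega> \<in> space M \<Longrightarrow> r (\<Delta> (int n) \<omega>) \<in> C \<longleftrightarrow> \<tau> n \<omega> = n"
    using F_in_F_infty by (auto simp: space_F)
  have split: "AE \<omega> in M. \<tau> (i + j) \<omega> = i \<longleftrightarrow> \<tau> i \<omega> = i \<and> \<Delta> (int i) \<omega> \<in> G j" for i j
    using full AE_space
  proof eventually_elim
    case (elim \<omega>)
    have "\<tau> (i + j) \<omega> = i \<longleftrightarrow> last_renewal \<Delta> ?\<gamma> (i + j) \<omega> = i"
      using elim(1) by simp
    also have "\<dots> \<longleftrightarrow> i \<in> renewal_set \<Delta> ?\<gamma> \<omega> \<and> enat j < ?\<gamma> (\<Delta> (int i) \<omega>)"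
      by (rule last_renewal_split[OF elim(2) first_full_ge_1])
    also have "\<dots> \<longleftrightarrow> \<tau> i \<omega> = i \<and> \<Delta> (int i) \<omega> \<in> G j"
      using elim shift_in_space by (simp add: G_def)
    finally show ?case .
  qed
  have split_n: "AE \<omega> in M. \<tau> (n + j) \<omega> = n \<longleftrightarrow> r (\<Delta> (int n) \<omega>) \<in> C \<and> \<Delta> (int n) \<omega> \<in> G j" for j
    using split[of n j] AE_space by eventually_elim (simp add: C_iff)
  \<comment> \<open>At \<open>i = 0\<close> the past carries no condition:
    \<open>\<tau> 0 = 0\<close> by the range of \<open>\<tau> 0\<close>, so the past event is the
    whole space.\<close>
  have split_0: "AE \<omega> in M. \<tau> (0 + j) \<omega> = 0 \<longleftrightarrow> r (\<Delta> (int 0) \<omega>) \<in> space M \<and> \<Delta> (int 0) \<omega> \<in> G j" for j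
    using split[of 0 j] AE_space
    by eventually_elim
      (use random_index_family_measurable(2)[OF \<tau>, of _ 0] reversal_in_space shift_in_space in auto)
  define N where "N = M \<Otimes>\<^sub>M measure_pmf (geometric_pmf (1/2))"
  define S where "S = F_infty M F \<Otimes>\<^sub>M count_space (UNIV :: nat set)"
  interpret N: prob_space N
    unfolding N_def by (intro prob_space_pair prob_space_axioms measure_pmf.prob_space_axioms)
  let ?X = "reversed_part \<Delta> r \<tau>" and ?Y = "forward_part \<Delta> \<tau>"
  have indep: "N.indep_var S ?X S ?Y" and distr: "distr N S ?X = distr N S ?Y"
    using splitting
    unfolding symmetric_splitting_def Let_def reversed_part_def[symmetric] forward_part_def[symmetric]
      N_def S_def by (auto dest!: spec[of _ "1/2 :: real"])
  \<comment> \<open>By equality of laws \<open>\<mu> A i\<close> is the mass of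
    \<open>A \<times> {i}\<close> for either part, so by independence a product of two values is a
    joint probability.\<close>
  define \<mu> where "\<mu> A i = measure (distr N S ?X) (A \<times> {i})" for A i
  have top: "space M \<in> sets (F_infty M F)"
    using sets.top[of "F_infty M F"] by (simp add: space_F_infty)
  have rect: "\<mu> A i * \<mu> B j = (1/2) * (1/2) ^ (i + j) * (prob (A \<inter> D) * prob (B \<inter> G j))"
    if sets: "A \<in> sets (F_infty M F)" "B \<in> sets (F_infty M F)" "D \<in> sets (F_infty M F)"
      and "AE \<omega> in M. \<tau> (i + j) \<omega> = i \<longleftrightarrow> r (\<Delta> (int i) \<omega>) \<in> D \<and> \<Delta> (int i) \<omega> \<in> G j" for A B D i j
  proof -
    have S: "A \<times> {i} \<in> sets S" "B \<times> {j} \<in> sets S"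
      unfolding S_def using sets by auto
    have "\<mu> A i * \<mu> B j = measure (distr N S ?X) (A \<times> {i}) * measure (distr N S ?Y) (B \<times> {j})"
      by (simp add: \<mu>_def distr)
    also have "\<dots> = N.prob (?X -` (A \<times> {i}) \<inter> space N) * N.prob (?Y -` (B \<times> {j}) \<inter> space N)"
      using S N.indep_var_rv1[OF indep] N.indep_var_rv2[OF indep] by (simp add: measure_distr)
    also have "\<dots> = N.prob ((\<lambda>x. (?X x, ?Y x)) -` ((A \<times> {i}) \<times> (B \<times> {j})) \<inter> space N)"
      using N.indep_varD[OF indep S] by simp
    also have "(\<lambda>x. (?X x, ?Y x)) -` ((A \<times> {i}) \<times> (B \<times> {j})) \<inter> space N =
        {x \<in> space N. ?X x \<in> A \<times> {i} \<and> ?Y x \<in> B \<times> {j}}"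
      by auto
    also have "N.prob \<dots> = (1/2) * (1/2) ^ (i + j) * (prob (A \<inter> D) * prob (B \<inter> G j))"
      using emeasure_parts_rectangle[of "1/2", OF _ _ \<tau> that(1-3) G that(4)]
      by (intro measure_eq_emeasure_eq_ennreal) (simp_all add: N_def)
    finally show ?thesis .
  qed
  have "prob (A \<inter> C) = prob (A \<inter> G n)" if A: "A \<in> sets (F_infty M F)" for A
  proof -
    \<comment> \<open>The first full time is at least 1, so at \<open>j = 0\<close> it is the future
      that carries no condition.\<close>
    have "enat 0 < ?\<gamma> \<omega>" for \<omega>
      by (rule less_le_trans[OF _ first_full_ge_1]) (simp add: zero_enat_def[symmetric])
    then have G0: "G 0 = space M" by (simp add: G_def)
    have "A \<subseteq> space M"
      using sets.sets_into_space[OF A] by (simp add: space_F_infty)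
    then have "\<mu> (space M) 0 * \<mu> A n = (1/2) * (1/2) ^ n * prob (A \<inter> G n)"
      using rect[OF top A top split_0] by (simp add: prob_space)
    moreover have "\<mu> A n * \<mu> (space M) 0 = (1/2) * (1/2) ^ n * prob (A \<inter> C)"
      using rect[OF A top C split_n] by (simp add: prob_space G0)
    ultimately show ?thesis by (simp add: mult.commute)
  qed
  then have "AE \<omega> in M. \<omega> \<in> C \<longleftrightarrow> \<omega> \<in> G n"
    by (rule AE_eq_of_prob_Int[OF C G sets_F_infty_subset])
  \<comment> \<open>The equality is pulled back along \<open>r\<close> after
    \<open>\<Delta> (int n)\<close>, which preserves \<open>M\<close> and turns \<open>C\<close>
    into the event that \<open>n\<close> is full.\<close>
  then have "AE \<omega> in M. r (\<Delta> (int n) \<omega>) \<in> C \<longleftrightarrow> r (\<Delta> (int n) \<omega>) \<in> G n"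
    by (intro AE_shift[OF AE_reversal])
  then show "AE \<omega> in M. n \<in> renewal_set \<Delta> ?\<gamma> \<omega> \<longleftrightarrow> enat n < ?\<gamma> (r (\<Delta> (int n) \<omega>))"
    using full AE_space
    by eventually_elim (simp add: C_iff G_def shift_in_space reversal_in_space)
qed

lemma first_full_in_self_dual_times:
  assumes "\<tau> \<in> honest_splittings M F \<Delta> r"
  shows "first_full \<tau> \<in> self_dual_times M F \<Delta> r"
  using assms self_dual_first_full[OF assms] positive_stopping_time_first_full
  by (auto simp: self_dual_times_def honest_splittings_def symmetric_splitting_def)

end

section \<open>The correspondence and the induced bijections of classes\<close>

theorem proposition2p15:
  fixes M :: "'a measure"
    and F :: "int \<Rightarrow> int \<Rightarrow> 'a measure"
    and \<Delta> :: "int \<Rightarrow> 'a \<Rightarrow> 'a"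
    and r :: "'a \<Rightarrow> 'a"
  assumes "time_symmetric_noise M F \<Delta> r"
  shows
    "let S = self_dual_times M F \<Delta> r;
         T = honest_splittings M F \<Delta> r
     in
       (\<forall>\<gamma>\<in>S. last_renewal \<Delta> \<gamma> \<in> T \<and> (AE \<omega> in M. first_full (last_renewal \<Delta> \<gamma>) \<omega> = \<gamma> \<omega>)) \<and>
       (\<forall>\<tau>\<in>T. first_full \<tau> \<in> S \<and>
          (\<forall>n. AE \<omega> in M. last_renewal \<Delta> (first_full \<tau>) n \<omega> = \<tau> n \<omega>)) \<and>
       bij_betw (\<lambda>C. AE_eq_families M T `` (last_renewal \<Delta> ` C))
         (S // AE_eq_times M S) (T // AE_eq_families M T) \<and>
       bij_betw (\<lambda>D. AE_eq_times M S `` (first_full ` D))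
         (T // AE_eq_families M T) (S // AE_eq_times M S)"
proof -
  interpret time_symmetric_noise M F \<Delta> r by fact
  define S where "S = self_dual_times M F \<Delta> r"
  define T where "T = honest_splittings M F \<Delta> r"
  have f: "last_renewal \<Delta> \<gamma> \<in> T" if "\<gamma> \<in> S" for \<gamma>
    using that last_renewal_in_honest_splittings unfolding S_def T_def by blast
  have g: "first_full \<tau> \<in> S" if "\<tau> \<in> T" for \<tau>
    using that first_full_in_self_dual_times unfolding S_def T_def by blast
  have gf: "AE \<omega> in M. first_full (last_renewal \<Delta> \<gamma>) \<omega> = \<gamma> \<omega>" if "\<gamma> \<in> S" for \<gamma>
    using that
    by (intro AE_I2 first_full_last_renewal) (auto simp: S_def self_dual_times_def positive_stopping_time_def)
  have fg: "AE \<omega> in M. last_renewal \<Delta> (first_full \<tau>) n \<omega> = \<tau> n \<omega>" if "\<tau> \<in> T" for \<tau> n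
    using honest_splitting_AE[OF that[unfolded T_def]] by eventually_elim blast
  have f_cong: "(last_renewal \<Delta> \<gamma>, last_renewal \<Delta> \<gamma>') \<in> AE_eq_families M T"
    if "(\<gamma>, \<gamma>') \<in> AE_eq_times M S" for \<gamma> \<gamma>'
    using that f last_renewal_cong_AE by (auto simp: AE_eq_times_def AE_eq_families_def)
  have g_cong: "(first_full \<tau>, first_full \<tau>') \<in> AE_eq_times M S"
    if "(\<tau>, \<tau>') \<in> AE_eq_families M T" for \<tau> \<tau>'
    using that g first_full_cong_AE by (auto simp: AE_eq_times_def AE_eq_families_def)
  have gf': "(first_full (last_renewal \<Delta> \<gamma>), \<gamma>) \<in> AE_eq_times M S" if "\<gamma> \<in> S" for \<gamma>
    using that f g gf by (simp add: AE_eq_times_def)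
  have fg': "(last_renewal \<Delta> (first_full \<tau>), \<tau>) \<in> AE_eq_families M T" if "\<tau> \<in> T" for \<tau>
    using that f g fg by (simp add: AE_eq_families_def)
  note equivs = equiv_AE_eq_times[of S M] equiv_AE_eq_families[of T M]
  have "bij_betw (\<lambda>C. AE_eq_families M T `` (last_renewal \<Delta> ` C))
      (S // AE_eq_times M S) (T // AE_eq_families M T)"
    by (rule bij_betw_quotients[where f = "last_renewal \<Delta>" and g = first_full, OF equivs f g f_cong g_cong gf' fg'])
  moreover have "bij_betw (\<lambda>D. AE_eq_times M S `` (first_full ` D))
      (T // AE_eq_families M T) (S // AE_eq_times M S)"
    by (rule bij_betw_quotients[where f = first_full and g = "last_renewal \<Delta>", OF equivs(2,1) g f g_cong f_cong fg' gf'])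
  ultimately show ?thesis
    unfolding Let_def S_def[symmetric] T_def[symmetric] using f g gf fg by blast
qed

end
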